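(* Let $d\mu_C$ be a non-trivial positive semi-definite $l\times l$ matrix-valued measure on the unit circle, normalized by $\mu_C(\partial\mathbb D)=\mathbf 1$ and invariant under $\theta\mapsto-\theta$, with (Hermitian) Verblunsky coefficients $(\alpha_n)_{n\ge0}$, and let $d\mu_I=\mathrm{Sz}(d\mu_C)$. Set $\alpha_{-1}=-\mathbf 1$. Then the coefficients of the associated CMV and Jacobi matrices satisfy the Geronimus relations: for $k\ge0$, $$B_{k+1}=\sqrt{\mathbf 1-\alpha_{2k-1}}\;\alpha_{2k}\sqrt{\mathbf 1-\alpha_{2k-1}}-\sqrt{\mathbf 1+\alpha_{2k-1}}\;\alpha_{2k-2}\sqrt{\mathbf 1+\alpha_{2k-1}},$$ $$A_{k+1}=\sqrt{\mathbf 1-\alpha_{2k-1}}\,\sqrt{\mathbf 1-\alpha_{2k}^2}\,\sqrt{\mathbf 1+\alpha_{2k+1}}.$$ That is, the block Jacobi matrix with Jacobi parameters $(A_n,B_n)_{n\ge1}$ given by these formulas is a block Jacobi matrix of the measure $d\mu_I$. (For $k=0$ the second term in $B_1$ vanishes since $\mathbf 1+\alpha_{-1}=0$.)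
   Context: Fix $l\ge1$; $^\dagger$ is the Hermitian adjoint, $\mathbf 1$ the $l\times l$ identity; square roots are of Hermitian positive semi-definite matrices. Unit circle: $\langle\!\langle f,g\rangle\!\rangle_R=\int f^\dagger\,d\mu_C\,g$, $\langle\!\langle f,g\rangle\!\rangle_L=\int g\,d\mu_C\,f^\dagger$. Non-trivial means $\operatorname{Tr}\langle\!\langle f,f\rangle\!\rangle_R>0$ for every non-zero matrix polynomial $f$. $\Phi_n^R,\Phi_n^L$ are the monic matrix polynomials of degree $n$ with $\langle\!\langle z^k\mathbf 1,\Phi_n^R\rangle\!\rangle_R=0$, $\langle\!\langle z^k\mathbf 1,\Phi_n^L\rangle\!\rangle_L=0$ for $0\le k<n$; $\varphi_n^R=\Phi_n^R\kappa_n^R$, $\varphi_n^L=\kappa_n^L\Phi_n^L$ with $\kappa_0^{R}=\kappa_0^{L}=\mathbf 1$, $\langle\!\langle\varphi_n^R,\varphi_n^R\rangle\!\rangle_R=\langle\!\langle\varphi_n^L,\varphi_n^L\rangle\!\rangle_L=\mathbf 1$, $\kappa_{n+1}^L(\kappa_n^L)^{-1}>0$, $(\kappa_n^R)^{-1}\kappa_{n+1}^R>0$. With $\varphi_n^{R,*}(z)=z^n\varphi_n^R(1/\bar z)^\dagger$ and $\rho_n^L=\kappa_n^L(\kappa_{n+1}^L)^{-1}$, the Verblunsky coefficients $\alpha_n$ are the $l\times l$ matrices with $z\varphi_n^L-\rho_n^L\varphi_{n+1}^L=\alpha_n^\dagger\varphi_n^{R,*}$; they satisfy $\|\alpha_n\|<1$.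 For a measure invariant under $\theta\mapsto-\theta$ one has $\alpha_n=\alpha_n^\dagger$ for all $n$. Szegő mapping: for $d\mu_C$ invariant under $\theta\mapsto-\theta$, $d\mu_I=\mathrm{Sz}(d\mu_C)$ is the matrix-valued measure on $[-2,2]$ with $\int f(x)\,d\mu_I(x)=\int f(2\cos\theta)\,d\mu_C(\theta)$ for measurable $f$. Real line: a block Jacobi matrix of $d\mu_I$ is a block matrix $J_{nm}=\int p_{n-1}^R(x)^\dagger\,d\mu_I(x)\,x\,p_{m-1}^R(x)$, $n,m\ge1$, for some sequence of right orthonormal matrix polynomials $p_n^R$ of degree $n$ with $\int (p_n^R)^\dagger d\mu_I\,p_m^R=\delta_{nm}\mathbf 1$ and $p_0^R=\mathbf 1$. It is block tridiagonal, with $B_n=J_{nn}$ and $A_n=J_{n,n+1}=J_{n+1,n}^\dagger$; different choices of $p_n^R$ lead to equivalent matrices, $\tilde B_n=u_n^\dagger B_nu_n$, $\tilde A_n=u_n^\dagger A_nu_{n+1}$ with $u_n$ unitary, $u_1=\mathbf 1$. *)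

theory Defs
  imports "HOL-Analysis.Analysis" "HOL-Computational_Algebra.Polynomial"
begin

section \<open>Complex matrices\<close>

definition adj :: "complex^'l^'l \<Rightarrow> complex^'l^'l" where
  "adj A = (\<chi> i j. cnj (A $ j $ i))"

definition cinner :: "complex^'l \<Rightarrow> complex^'l \<Rightarrow> complex" where
  "cinner v w = (\<Sum>i\<in>UNIV. cnj (v $ i) * w $ i)"

definition psd :: "complex^'l^'l \<Rightarrow> bool" where
  "psd A \<longleftrightarrow> adj A = A \<and> (\<forall>v. 0 \<le> Re (cinner v (A *v v)))"

definition posdef :: "complex^'l^'l \<Rightarrow> bool" where
  "posdef A \<longleftrightarrow> adj A = A \<and> (\<forall>v. v \<noteq> 0 \<longrightarrow> 0 < Re (cinner v (A *v v)))"

definition mat_sqrt :: "complex^'l^'l \<Rightarrow> complex^'l^'l" where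
  "mat_sqrt A = (THE B. psd B \<and> B ** B = A)"


section \<open>Matrix-valued measures\<close>

text \<open>A matrix-valued measure is a countably additive set function with positive semi-definite
  values on a sigma-algebra. The argument \<open>A\<close>, of type \<open>'a measure\<close>, only supplies the underlying
  measurable space; its own measure plays no role, and the values of \<open>\<mu>\<close> outside
  \<open>sets A\<close> are irrelevant.\<close>

definition matrix_measure :: "'a measure \<Rightarrow> ('a set \<Rightarrow> complex^'l^'l) \<Rightarrow> bool" where
  "matrix_measure A \<mu> \<longleftrightarrow>
     (\<forall>X\<in>sets A. psd (\<mu> X)) \<and>
     (\<forall>F::nat \<Rightarrow> 'a set. range F \<subseteq> sets A \<longrightarrow> disjoint_family F \<longrightarrow>
        (\<lambda>i. \<mu> (F i)) sums \<mu> (\<Union>i. F i))"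

text \<open>The finite positive scalar measure \<open>X \<mapsto> v\<^sup>\<dagger> \<mu>(X) v\<close>.\<close>

definition scalar_measure ::
    "'a measure \<Rightarrow> ('a set \<Rightarrow> complex^'l^'l) \<Rightarrow> complex^'l \<Rightarrow> 'a measure" where
  "scalar_measure A \<mu> v =
     measure_of (space A) (sets A) (\<lambda>X. ennreal (Re (cinner v (\<mu> X *v v))))"

text \<open>The integral of a scalar function against the complex measure \<open>X \<mapsto> \<mu>(X) $ i $ j\<close>. By
  polarization, that complex measure is a combination of four finite positive measures:
  \<open>4 \<mu>(X) $ i $ j = \<Sum>k<4. (-\<i>)^k * (v\<^sub>k\<^sup>\<dagger> \<mu>(X) v\<^sub>k)\<close> with \<open>v\<^sub>k = e\<^sub>i + \<i>^k e\<^sub>j\<close>.\<close>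

definition entry_integral ::
    "'a measure \<Rightarrow> ('a set \<Rightarrow> complex^'l^'l) \<Rightarrow> 'l \<Rightarrow> 'l \<Rightarrow> ('a \<Rightarrow> complex) \<Rightarrow> complex" where
  "entry_integral A \<mu> i j h =
     (\<Sum>k<4. (-\<i>) ^ k * (LINT x|scalar_measure A \<mu> (axis i 1 + axis j (\<i> ^ k)). h x)) / 4"

text \<open>The matrix integral \<open>\<integral> F d\<mu> G\<close>; the order of the factors matters.\<close>

definition mat_integral ::
    "'a measure \<Rightarrow> ('a set \<Rightarrow> complex^'l^'l) \<Rightarrow> ('a \<Rightarrow> complex^'l^'l) \<Rightarrow> ('a \<Rightarrow> complex^'l^'l)
      \<Rightarrow> complex^'l^'l" where
  "mat_integral A \<mu> F G =
     (\<chi> j k. \<Sum>m\<in>UNIV. \<Sum>n\<in>UNIV. entry_integral A \<mu> m n (\<lambda>x. F x $ j $ m * G x $ n $ k))"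


section \<open>Matrix polynomials\<close>

text \<open>A matrix polynomial is represented by its coefficients as an element of
  \<open>(complex^'l^'l) poly\<close>. The library's evaluation \<^term>\<open>poly\<close> must not be used here, since the
  type class multiplication on vectors is componentwise. Likewise the identity matrix is
  \<^term>\<open>mat 1\<close>, not \<open>1\<close>.\<close>

definition mp_eval :: "(complex^'l^'l) poly \<Rightarrow> complex \<Rightarrow> complex^'l^'l" where
  "mp_eval p z = (\<Sum>k\<le>degree p. mat (z ^ k) ** coeff p k)"

definition mp_monic :: "nat \<Rightarrow> (complex^'l^'l) poly \<Rightarrow> bool" where
  "mp_monic n p \<longleftrightarrow> degree p = n \<and> coeff p n = mat 1"


section \<open>Orthogonal matrix polynomials on the unit circle\<close>

abbreviation circle :: "complex measure" where
  "circle \<equiv> restrict_space borel (sphere 0 1)"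

definition inner_R ::
    "(complex set \<Rightarrow> complex^'l^'l) \<Rightarrow> (complex \<Rightarrow> complex^'l^'l) \<Rightarrow> (complex \<Rightarrow> complex^'l^'l)
      \<Rightarrow> complex^'l^'l" where
  "inner_R \<mu> f g = mat_integral circle \<mu> (\<lambda>z. adj (f z)) g"

definition inner_L ::
    "(complex set \<Rightarrow> complex^'l^'l) \<Rightarrow> (complex \<Rightarrow> complex^'l^'l) \<Rightarrow> (complex \<Rightarrow> complex^'l^'l)
      \<Rightarrow> complex^'l^'l" where
  "inner_L \<mu> f g = mat_integral circle \<mu> g (\<lambda>z. adj (f z))"

definition nontrivial :: "(complex set \<Rightarrow> complex^'l^'l) \<Rightarrow> bool" where
  "nontrivial \<mu> \<longleftrightarrow>
     (\<forall>f. f \<noteq> 0 \<longrightarrow> 0 < Re (trace (inner_R \<mu> (mp_eval f) (mp_eval f))))"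

definition conj_invariant :: "(complex set \<Rightarrow> complex^'l^'l) \<Rightarrow> bool" where
  "conj_invariant \<mu> \<longleftrightarrow> (\<forall>X\<in>sets circle. \<mu> (cnj ` X) = \<mu> X)"

text \<open>\<open>verblunsky \<mu> \<alpha>\<close>: the sequence of Verblunsky coefficients of \<open>\<mu>\<close> is \<open>\<alpha>\<close>. For nontrivial
  normalized \<open>\<mu>\<close> all the data \<open>\<Phi>R\<close>, \<open>\<Phi>L\<close>, \<open>\<kappa>R\<close>, \<open>\<kappa>L\<close>, \<open>\<alpha>\<close> are uniquely determined. The recursion
  is an identity of polynomials, and it is imposed only at \<open>z \<noteq> 0\<close>, where
  \<open>\<phi>R* z = z^n \<phi>R(1 / cnj z)\<^sup>\<dagger>\<close> can be evaluated literally.\<close>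

definition verblunsky ::
    "(complex set \<Rightarrow> complex^'l^'l) \<Rightarrow> (nat \<Rightarrow> complex^'l^'l) \<Rightarrow> bool" where
  "verblunsky \<mu> \<alpha> \<longleftrightarrow>
     (\<exists>\<Phi>R \<Phi>L \<kappa>R \<kappa>L.
        (\<forall>n. mp_monic n (\<Phi>R n) \<and> mp_monic n (\<Phi>L n)) \<and>
        (\<forall>n. \<forall>k<n. inner_R \<mu> (\<lambda>z. mat (z ^ k)) (mp_eval (\<Phi>R n)) = 0) \<and>
        (\<forall>n. \<forall>k<n. inner_L \<mu> (\<lambda>z. mat (z ^ k)) (mp_eval (\<Phi>L n)) = 0) \<and>
        \<kappa>R 0 = mat 1 \<and> \<kappa>L 0 = mat 1 \<and>
        (\<forall>n. posdef (matrix_inv (\<kappa>R n) ** \<kappa>R (Suc n))) \<and>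
        (\<forall>n. posdef (\<kappa>L (Suc n) ** matrix_inv (\<kappa>L n))) \<and>
        (let \<phi>R = (\<lambda>n z. mp_eval (\<Phi>R n) z ** \<kappa>R n);
             \<phi>L = (\<lambda>n z. \<kappa>L n ** mp_eval (\<Phi>L n) z);
             \<phi>R_star = (\<lambda>n z. mat (z ^ n) ** adj (\<phi>R n (1 / cnj z)));
             \<rho>L = (\<lambda>n. \<kappa>L n ** matrix_inv (\<kappa>L (Suc n)))
         in (\<forall>n. inner_R \<mu> (\<phi>R n) (\<phi>R n) = mat 1 \<and> inner_L \<mu> (\<phi>L n) (\<phi>L n) = mat 1) \<and>
            (\<forall>n z. z \<noteq> 0 \<longrightarrow>
               mat z ** \<phi>L n z - \<rho>L n ** \<phi>L (Suc n) z = adj (\<alpha> n) ** \<phi>R_star n z)))"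


section \<open>Szego mapping and block Jacobi matrices\<close>

abbreviation interval :: "real measure" where
  "interval \<equiv> restrict_space borel {-2..2}"

text \<open>\<open>\<mu>I\<close> is the Szego image of \<open>\<mu>C\<close>; for \<open>z = exp (\<i> * \<theta>)\<close> one has \<open>2 * Re z = 2 * cos \<theta>\<close>.\<close>

definition szego_image ::
    "(complex set \<Rightarrow> complex^'l^'l) \<Rightarrow> (real set \<Rightarrow> complex^'l^'l) \<Rightarrow> bool" where
  "szego_image \<mu>C \<mu>I \<longleftrightarrow>
     matrix_measure interval \<mu>I \<and>
     (\<forall>f\<in>borel_measurable interval. \<forall>i j.
        entry_integral interval \<mu>I i j f = entry_integral circle \<mu>C i j (\<lambda>z. f (2 * Re z)))"

text \<open>Block matrices are indexed by \<open>n, m \<ge> 1\<close>; entries with index \<open>0\<close> are ignored.\<close>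

definition block_tridiagonal ::
    "(nat \<Rightarrow> complex^'l^'l) \<Rightarrow> (nat \<Rightarrow> complex^'l^'l) \<Rightarrow> nat \<Rightarrow> nat \<Rightarrow> complex^'l^'l" where
  "block_tridiagonal A B n m =
     (if n = m then B n
      else if m = Suc n then A n
      else if n = Suc m then adj (A m)
      else 0)"

definition block_jacobi_matrix ::
    "(real set \<Rightarrow> complex^'l^'l) \<Rightarrow> (nat \<Rightarrow> nat \<Rightarrow> complex^'l^'l) \<Rightarrow> bool" where
  "block_jacobi_matrix \<mu> J \<longleftrightarrow>
     (\<exists>P. let p = (\<lambda>n x. mp_eval (P n) (complex_of_real x)) in
        (\<forall>n. degree (P n) = n) \<and>
        P 0 = [:mat 1:] \<and>
        (\<forall>n m. mat_integral interval \<mu> (\<lambda>x. adj (p n x)) (p m) = (if n = m then mat 1 else 0)) \<and>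
        (\<forall>n\<ge>1. \<forall>m\<ge>1.
           J n m = mat_integral interval \<mu> (\<lambda>x. adj (p (n - 1) x))
                     (\<lambda>x. mat (complex_of_real x) ** p (m - 1) x)))"


section \<open>The integral extends the set function\<close>


lemma Re_cinner_sums:
  assumes "f sums S"
  shows "(\<lambda>i. Re (cinner v (f i *v v))) sums Re (cinner v (S *v v))"
proof -
  have e: "(\<lambda>i. f i $ a $ b) sums (S $ a $ b)" for a b
    using tendsto_vec_nth[OF tendsto_vec_nth[OF assms[unfolded sums_def], of a], of b]
    by (simp add: sums_def)
  have "(\<lambda>i. cinner v (f i *v v)) sums cinner v (S *v v)"
    unfolding cinner_def matrix_vector_mult_def
    by (auto intro!: sums_sum sums_mult sums_mult2 e)
  then show ?thesis by (rule sums_Re)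
qed

lemma emeasure_scalar_measure:
  assumes "matrix_measure A \<mu>" "X \<in> sets A"
  shows "emeasure (scalar_measure A \<mu> v) X = ennreal (Re (cinner v (\<mu> X *v v)))"
proof (rule emeasure_measure_of[OF scalar_measure_def])
  show "sets A \<subseteq> Pow (space A)" by (rule sets.space_closed)
  show "X \<in> sets (scalar_measure A \<mu> v)" using assms by (simp add: scalar_measure_def)
  have nn: "0 \<le> Re (cinner v (\<mu> X *v v))" if "X \<in> sets A" for X
    using assms(1) that by (auto simp: matrix_measure_def psd_def)
  have ca: "(\<lambda>i. \<mu> (F i)) sums \<mu> (\<Union>i. F i)" if "range F \<subseteq> sets A" "disjoint_family F" for F :: "nat \<Rightarrow> _"
    using assms(1) that by (auto simp: matrix_measure_def)
  have "(\<lambda>i::nat. \<mu> {}) sums \<mu> {}" using ca[of "\<lambda>_. {}"] by (simp add: disjoint_family_on_def)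
  then have "\<mu> {} = 0" using sums_summable summable_LIMSEQ_zero LIMSEQ_const_iff by blast
  then show "positive (sets (scalar_measure A \<mu> v)) (\<lambda>X. ennreal (Re (cinner v (\<mu> X *v v))))"
    by (simp add: positive_def cinner_def)
  show "countably_additive (sets (scalar_measure A \<mu> v)) (\<lambda>X. ennreal (Re (cinner v (\<mu> X *v v))))"
  proof (rule countably_additiveI)
    fix F :: "nat \<Rightarrow> 'a set" assume F: "range F \<subseteq> sets (scalar_measure A \<mu> v)" "disjoint_family F"
    then have F': "range F \<subseteq> sets A" by (simp add: scalar_measure_def)
    then have "(\<lambda>i. Re (cinner v (\<mu> (F i) *v v))) sums Re (cinner v (\<mu> (\<Union>i. F i) *v v))"
      using ca F Re_cinner_sums by blast
    then show "(\<Sum>i. ennreal (Re (cinner v (\<mu> (F i) *v v)))) = ennreal (Re (cinner v (\<mu> (\<Union>i. F i) *v v)))"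
      using F' by (intro suminf_ennreal_eq nn) auto
  qed
qed

lemma cinner_axis: "cinner (axis i a + axis j b) (M *v (axis i a + axis j b))
   = cnj a * M$i$i * a + cnj a * M$i$j * b + cnj b * M$j$i * a + cnj b * M$j$j * b"
proof -
  have 1: "(M *v (axis i a + axis j b)) $ m = M$m$i * a + M$m$j * b" for m
    by (simp add: matrix_vector_mult_def axis_def distrib_left sum.distrib if_distrib[of "(*) _"] cong: if_cong)
  show ?thesis
    unfolding cinner_def 1
    by (simp add: axis_def distrib_right sum.distrib if_distrib[of cnj] if_distrib[of "\<lambda>x. x * _"] cong: if_cong)
      (simp add: algebra_simps)
qed

lemma entry_integral_indicator:
  assumes mm: "matrix_measure A \<mu>" and X: "X \<in> sets A"
  shows "entry_integral A \<mu> i j (indicator X) = \<mu> X $ i $ j"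
proof -
  have herm: "cnj (\<mu> X $ a $ b) = \<mu> X $ b $ a" for a b
  proof -
    have "adj (\<mu> X) = \<mu> X" using mm X by (auto simp: matrix_measure_def psd_def)
    then show ?thesis by (metis (no_types, lifting) adj_def vec_lambda_beta)
  qed
  have ip: "0 \<le> Re (cinner v (\<mu> X *v v))" for v
    using mm X by (auto simp: matrix_measure_def psd_def)
  have I: "(LINT x|scalar_measure A \<mu> v. indicator X x) = complex_of_real (Re (cinner v (\<mu> X *v v)))" for v
  proof -
    have s: "sets (scalar_measure A \<mu> v) = sets A" "space (scalar_measure A \<mu> v) = space A"
      by (auto simp: scalar_measure_def)
    have "X \<inter> space A = X" using sets.sets_into_space[OF X] by auto
    then have 0: "measure (scalar_measure A \<mu> v) X = Re (cinner v (\<mu> X *v v))"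
      using emeasure_scalar_measure[OF mm X, of v] ip[of v] by (simp add: measure_def)
    have "(LINT x|scalar_measure A \<mu> v. complex_of_real (indicator X x)) = of_real (LINT x|scalar_measure A \<mu> v. indicator X x)"
      by (rule integral_complex_of_real)
    moreover have "(LINT x|scalar_measure A \<mu> v. indicator X x) = measure (scalar_measure A \<mu> v) X"
      using \<open>X \<inter> space A = X\<close> s by simp
    moreover have "complex_of_real (indicator X x) = indicator X x" for x by (simp add: indicator_def)
    ultimately show ?thesis using 0 by simp
  qed
  have real: "complex_of_real (Re (cinner v (\<mu> X *v v))) = cinner v (\<mu> X *v v)" if v: "v = axis i 1 + axis j b" for b v
  proof -
    have "cnj (cinner v (\<mu> X *v v)) = cinner v (\<mu> X *v v)"
      unfolding v cinner_axis by (simp add: herm algebra_simps)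
    then show ?thesis by (simp add: complex_eq_iff)
  qed
  show ?thesis
    unfolding entry_integral_def I
    using arg_cong[OF herm[of i j], of Re] arg_cong[OF herm[of i j], of Im]
    by (simp only: real[OF refl] cinner_axis)
      (simp add: eval_nat_numeral lessThan_Suc algebra_simps complex_eq_iff)
qed

end

theory Submission
  imports Defs
begin

text \<open>The idea is to write the orthonormal polynomials of the Szego image explicitly in terms of the
orthonormal polynomials \<open>\<phi>\<^bsub>n\<^esub> = \<phi>\<^sup>R\<^bsub>n\<^esub>\<close> on the circle and to compute their Jacobi matrix on the circle,
since \<open>\<integral> f(x) d\<mu>\<^sub>I\<close> is the integral of \<open>f(z + 1/z)\<close> against \<open>\<mu>\<^sub>C\<close>.

For a measure that is invariant under conjugation, left and right polynomials are related by
\<open>\<phi>\<^sup>L(z) = \<phi>\<^sup>R(cnj z)\<^sup>\<dagger>\<close>. The recursion that defines the Verblunsky coefficients then reads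
\<open>z \<phi>\<^bsub>n\<^esub> = \<phi>\<^bsub>n+1\<^esub> \<rho>\<^bsub>n\<^esub> + \<phi>s\<^bsub>n\<^esub> \<alpha>\<^bsub>n\<^esub>\<close>, where \<open>\<phi>s\<^bsub>n\<^esub> = z\<^sup>n \<phi>\<^bsub>n\<^esub>(1/z)\<close>
(\<open>symmetric_szego_recursion_of_verblunsky\<close>). From it one gets that \<open>\<alpha>\<^bsub>n\<^esub>\<close> is Hermitian, that
\<open>\<rho>\<^bsub>n\<^esub>\<^sup>2 = 1 - \<alpha>\<^bsub>n\<^esub>\<^sup>2\<close>, and all inner products of \<open>\<phi>\<^bsub>n\<^esub>\<close> and \<open>\<phi>s\<^bsub>n\<^esub>\<close> with each other and with their products by \<open>z\<close>;
for instance \<open>\<langle>\<phi>\<^bsub>n\<^esub>, \<phi>s\<^bsub>n\<^esub>\<rangle> = - \<alpha>\<^bsub>n-1\<^esub>\<close>, which for \<open>n = 0\<close> explains the convention \<open>\<alpha>\<^bsub>-1\<^esub> = -1\<close>.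

The functions \<open>e\<^bsub>k\<^esub> = z\<^sup>-\<^sup>k \<phi>\<^bsub>2k\<^esub>(z) + z\<^sup>k \<phi>\<^bsub>2k\<^esub>(1/z)\<close> are invariant under \<open>z \<mapsto> 1/z\<close> and are therefore matrix polynomials of
degree \<open>k\<close> in \<open>x = z + 1/z\<close>. They are mutually orthogonal with squared norm \<open>2 (1 - \<alpha>\<^bsub>2k-1\<^esub>)\<close>
(\<open>R_e_perp\<close>, \<open>R_e_e\<close>), so that \<open>p\<^bsub>k\<^esub> = e\<^bsub>k\<^esub> (2 (1 - \<alpha>\<^bsub>2k-1\<^esub>))\<^sup>-\<^sup>1\<^sup>/\<^sup>2\<close> are right orthonormal polynomials for the Szego image. The
inner products of \<open>e\<^bsub>k\<^esub>\<close> with \<open>x e\<^bsub>m\<^esub>\<close> (\<open>R_e_x_e_diag_Suc\<close>, \<open>R_e_x_e_Suc\<close>) come out as polynomials in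
\<open>\<alpha>\<close> and \<open>\<rho>\<close>. Inserting \<open>\<rho>\<^bsub>2k-1\<^esub> = (1 - \<alpha>\<^bsub>2k-1\<^esub>)\<^sup>1\<^sup>/\<^sup>2 (1 + \<alpha>\<^bsub>2k-1\<^esub>)\<^sup>1\<^sup>/\<^sup>2\<close> (\<open>T_S_eq_\<rho>\<close>)
and cancelling the normalization gives the Geronimus relations.

The square roots need existence, uniqueness and commutation properties for positive semi-definite
complex matrices. These are obtained from a monotone iteration whose steps are polynomials in the
matrix.\<close>

section \<open>Complex matrices and positivity\<close>

lemma matrix_add_rdistrib: "(B + C) ** A = B ** A + (C :: complex^'l^'l) ** A"
  by (simp add: matrix_matrix_mult_def vec_eq_iff distrib_right sum.distrib)

lemma matrix_diff_ldistrib: "A ** (B - C) = A ** B - A ** (C :: complex^'l^'l)"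
  by (simp add: matrix_matrix_mult_def vec_eq_iff right_diff_distrib sum_subtractf)

lemma matrix_diff_rdistrib: "(B - C) ** A = B ** A - (C :: complex^'l^'l) ** A"
  by (simp add: matrix_matrix_mult_def vec_eq_iff left_diff_distrib sum_subtractf)

lemma matrix_minus_left: "(- A) ** B = - (A ** (B :: complex^'l^'l))"
  by (simp add: matrix_matrix_mult_def vec_eq_iff sum_negf)

lemma matrix_minus_right: "A ** (- B) = - (A ** (B :: complex^'l^'l))"
  by (simp add: matrix_matrix_mult_def vec_eq_iff sum_negf)

lemma matrix_zero_left [simp]: "0 ** (A :: complex^'l^'l) = 0"
  by (simp add: matrix_matrix_mult_def vec_eq_iff)

lemma matrix_zero_right [simp]: "A ** (0 :: complex^'l^'l) = 0"
  by (simp add: matrix_matrix_mult_def vec_eq_iff)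

lemma matrix_scaleR_left: "(r *\<^sub>R A) ** B = r *\<^sub>R (A ** (B :: complex^'l^'l))"
  by (simp add: matrix_matrix_mult_def vec_eq_iff scaleR_sum_right)

lemma matrix_scaleR_right: "A ** (r *\<^sub>R B) = r *\<^sub>R (A ** (B :: complex^'l^'l))"
  by (simp add: matrix_matrix_mult_def vec_eq_iff scaleR_sum_right)

lemmas matrix_ring_simps =
  matrix_add_ldistrib matrix_add_rdistrib matrix_diff_ldistrib matrix_diff_rdistrib
  matrix_minus_left matrix_minus_right matrix_scaleR_left matrix_scaleR_right

lemma mat_mult_entry [simp]: "(mat c ** A) $ i $ j = c * (A :: complex^'l^'l) $ i $ j"
  by (simp add: matrix_matrix_mult_def mat_def if_distrib[of "\<lambda>x. x * _"] cong: if_cong)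

lemma mult_mat_entry [simp]: "((A :: complex^'l^'l) ** mat c) $ i $ j = c * A $ i $ j"
  by (simp add: matrix_matrix_mult_def mat_def if_distrib[of "\<lambda>x. _ * x"] cong: if_cong)

lemma mat_commute: "A ** mat c = mat c ** (A :: complex^'l^'l)"
  by (simp add: vec_eq_iff)

lemma mat_mult_mat [simp]: "mat a ** mat b = (mat (a * b) :: complex^'l^'l)"
  by (simp add: vec_eq_iff) (simp add: mat_def)

lemma mat_mult_mat_assoc [simp]: "mat a ** (mat b ** A) = mat (a * b) ** (A :: complex^'l^'l)"
  by (simp add: matrix_mul_assoc)

lemma adj_entry: "adj A $ i $ j = cnj (A $ j $ i)"
  by (simp add: adj_def)

lemma adj_adj [simp]: "adj (adj A) = A"
  by (simp add: vec_eq_iff adj_entry)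

lemma adj_mult: "adj (A ** B) = adj B ** adj A"
  by (simp add: vec_eq_iff adj_entry matrix_matrix_mult_def mult.commute)

lemma adj_add: "adj (A + B) = adj A + adj B"
  by (simp add: vec_eq_iff adj_entry)

lemma adj_diff: "adj (A - B) = adj A - adj B"
  by (simp add: vec_eq_iff adj_entry)

lemma adj_minus: "adj (- A) = - adj A"
  by (simp add: vec_eq_iff adj_entry)

lemma adj_scaleR: "adj (r *\<^sub>R A) = r *\<^sub>R adj A"
  by (simp add: vec_eq_iff adj_entry complex_eq_iff)

lemma adj_mat [simp]: "adj (mat c) = mat (cnj c)"
  by (simp add: vec_eq_iff adj_entry) (simp add: mat_def)

lemma adj_zero [simp]: "adj 0 = 0"
  by (simp add: vec_eq_iff adj_entry)

lemmas adj_simps = adj_mult adj_add adj_diff adj_minus adj_scaleR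

text \<open>The real part of the Hermitian inner product is the inner product of \<^typ>\<open>complex^'l\<close> as a
Euclidean space. Positivity of matrices is therefore a statement about real quadratic forms, and
the estimates and the polarization identity for real inner products apply to it.\<close>

lemma Re_cinner: "Re (cinner v w) = v \<bullet> w"
  by (simp add: cinner_def inner_vec_def inner_complex_def)

lemma inner_adj: "v \<bullet> (A *v w) = (adj A *v v) \<bullet> w"
proof -
  have "cinner v (A *v w) = (\<Sum>i\<in>UNIV. \<Sum>j\<in>UNIV. cnj (v $ i) * A $ i $ j * w $ j)"
    by (simp add: cinner_def matrix_vector_mult_def sum_distrib_left mult.assoc)
  also have "\<dots> = (\<Sum>j\<in>UNIV. \<Sum>i\<in>UNIV. cnj (v $ i) * A $ i $ j * w $ j)"
    by (rule sum.swap)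
  also have "\<dots> = cinner (adj A *v v) w"
    by (simp add: cinner_def matrix_vector_mult_def adj_entry sum_distrib_right sum_distrib_left
        mult.commute mult.left_commute)
  finally show ?thesis by (metis Re_cinner)
qed

lemma psd_iff: "psd A \<longleftrightarrow> adj A = A \<and> (\<forall>v. 0 \<le> v \<bullet> (A *v v))"
  by (simp add: psd_def Re_cinner)

lemma posdef_iff: "posdef A \<longleftrightarrow> adj A = A \<and> (\<forall>v. v \<noteq> 0 \<longrightarrow> 0 < v \<bullet> (A *v v))"
  by (simp add: posdef_def Re_cinner)

lemma posdef_imp_psd: "posdef A \<Longrightarrow> psd A"
  unfolding psd_iff posdef_iff by (metis inner_zero_left less_eq_real_def)

lemma posdef_hermitian: "posdef A \<Longrightarrow> adj A = A" and psd_hermitian: "psd A \<Longrightarrow> adj A = A"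
  by (auto simp: posdef_def psd_def)

lemma matrix_vector_scaleR: "(r *\<^sub>R A) *v v = r *\<^sub>R (A *v (v :: complex^'l))"
  by (simp add: vec_eq_iff matrix_vector_mult_def scaleR_sum_right)

lemma psd_add: "psd A \<Longrightarrow> psd B \<Longrightarrow> psd (A + B)"
  by (simp add: psd_iff adj_simps matrix_vector_mult_add_rdistrib inner_add_right)

lemma posdef_psd_add: "psd A \<Longrightarrow> posdef B \<Longrightarrow> posdef (A + B)"
  by (auto simp: psd_iff posdef_iff adj_simps matrix_vector_mult_add_rdistrib inner_add_right
      add_nonneg_pos)

lemma psd_scaleR: "psd A \<Longrightarrow> 0 \<le> r \<Longrightarrow> psd (r *\<^sub>R A)"
  by (simp add: psd_iff adj_simps matrix_vector_scaleR)

lemma posdef_scaleR: "posdef A \<Longrightarrow> 0 < r \<Longrightarrow> posdef (r *\<^sub>R A)"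
  by (simp add: posdef_iff adj_simps matrix_vector_scaleR)

lemma posdef_mat1: "posdef (mat 1)"
  by (simp add: posdef_iff)

lemma psd_zero: "psd 0"
  by (simp add: psd_iff)

text \<open>The main source of positivity below: a product is seen to be positive semi-definite by writing it,
or the summands of an expression for it, as \<open>C\<^sup>\<dagger> A C\<close>.\<close>

lemma psd_congruence: "psd A \<Longrightarrow> psd (adj C ** A ** C)"
  by (simp add: psd_iff adj_simps matrix_mul_assoc)
     (metis inner_adj adj_adj matrix_vector_mul_assoc)

lemma psd_square: "adj A = A \<Longrightarrow> psd (A ** A)"
  using psd_congruence[OF posdef_imp_psd[OF posdef_mat1], of A] by simp

text \<open>Both quadratic forms vanish because they are non-negative with sum zero, and by polarization a
Hermitian matrix is determined by its quadratic form.\<close>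

lemma psd_sum_eq_zero:
  assumes "psd A" "psd B" "A + B = 0"
  shows "A = 0"
proof -
  have 0: "v \<bullet> (A *v v) = 0" for v
  proof -
    have "v \<bullet> (A *v v) + v \<bullet> (B *v v) = 0"
      using assms(3) by (metis inner_add_right inner_zero_right matrix_vector_mult_0 matrix_vector_mult_add_rdistrib)
    then show ?thesis using assms(1,2) unfolding psd_iff by (smt (verit))
  qed
  have herm: "adj A = A" using assms(1) by (rule psd_hermitian)
  have "v \<bullet> (A *v w) = 0" for v w
  proof -
    have "(v + w) \<bullet> (A *v (v + w)) = 2 * (v \<bullet> (A *v w))"
      using 0[of v] 0[of w] inner_adj[of w A v] herm
      by (simp add: inner_add_left inner_add_right matrix_vector_right_distrib inner_commute)
    then show ?thesis using 0[of "v + w"] by simp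
  qed
  then have "A *v w = 0" for w by (metis inner_eq_zero_iff)
  then show ?thesis by (metis matrix_eq matrix_vector_mult_0)
qed

lemma hermitian_square_zero:
  assumes "adj A = A" "A ** A = 0"
  shows "A = 0"
proof -
  have "(A *v v) \<bullet> (A *v v) = 0" for v
    using inner_adj[of v A "A *v v"] assms by (simp add: matrix_vector_mul_assoc)
  then show ?thesis by (metis inner_eq_zero_iff matrix_eq matrix_vector_mult_0)
qed

section \<open>Positive square roots\<close>

text \<open>With \<open>D = S - B\<close> commutation gives \<open>(S + B) D = S\<^sup>2 - B\<^sup>2 = 0\<close>, hence \<open>D S D + D B D = 0\<close>. Both terms
are positive semi-definite, so each of them vanishes, their difference \<open>D\<^sup>3\<close> is zero, and a
Hermitian matrix that is nilpotent is zero.\<close>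

lemma psd_sqrt_unique_of_commuting:
  assumes S: "psd S" and B: "psd B" and eq: "S ** S = B ** B" and comm: "S ** B = B ** S"
  shows "S = B"
proof -
  define D where "D = S - B"
  have hD: "adj D = D" using S B by (simp add: D_def adj_simps psd_hermitian)
  have "(S + B) ** D = 0" using eq comm by (simp add: D_def matrix_ring_simps)
  then have sum0: "D ** S ** D + D ** B ** D = 0"
    by (simp add: matrix_add_ldistrib[symmetric] matrix_add_rdistrib[symmetric] matrix_mul_assoc[symmetric])
  have p: "psd (D ** S ** D)" "psd (D ** B ** D)"
    using psd_congruence[OF S, of D] psd_congruence[OF B, of D] hD by auto
  have "D ** S ** D = 0" using psd_sum_eq_zero[OF p sum0] .
  moreover have "D ** B ** D = 0" using psd_sum_eq_zero[OF p(2,1)] sum0 by (simp add: add.commute)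
  moreover have "D ** D ** D = D ** S ** D - D ** B ** D"
    by (simp add: D_def matrix_ring_simps)
  ultimately have "(D ** D) ** (D ** D) = 0" by (simp add: matrix_mul_assoc)
  then have "D ** D = 0" using hermitian_square_zero[of "D ** D"] hD by (simp add: adj_simps)
  then have "D = 0" using hermitian_square_zero hD by blast
  then show ?thesis by (simp add: D_def)
qed

lemma tendsto_matrix_entries:
  fixes F :: "'a \<Rightarrow> complex^'l^'l"
  shows "(F \<longlongrightarrow> L) net \<longleftrightarrow> (\<forall>i j. ((\<lambda>n. F n $ i $ j) \<longlongrightarrow> L $ i $ j) net)"
  by (auto intro: vec_tendstoI tendsto_vec_nth)

lemma tendsto_matrix_mult:
  fixes F G :: "'a \<Rightarrow> complex^'l^'l"
  assumes "(F \<longlongrightarrow> L) net" "(G \<longlongrightarrow> M) net"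
  shows "((\<lambda>n. F n ** G n) \<longlongrightarrow> L ** M) net"
  using assms unfolding tendsto_matrix_entries
  by (auto simp: matrix_matrix_mult_def intro!: tendsto_sum tendsto_mult)

lemma tendsto_adj:
  fixes F :: "'a \<Rightarrow> complex^'l^'l"
  assumes "(F \<longlongrightarrow> L) net"
  shows "((\<lambda>n. adj (F n)) \<longlongrightarrow> adj L) net"
  using assms unfolding tendsto_matrix_entries by (auto simp: adj_entry intro!: tendsto_cnj)

lemma psd_limit:
  fixes F :: "nat \<Rightarrow> complex^'l^'l"
  assumes F: "F \<longlonglongrightarrow> L" and p: "\<And>n. psd (F n)"
  shows "psd L"
proof -
  have "adj L = L"
    using LIMSEQ_unique[OF tendsto_adj[OF F] ] F p by (simp add: psd_hermitian)
  moreover have "0 \<le> v \<bullet> (L *v v)" for v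
  proof (rule LIMSEQ_le_const)
    have "(\<lambda>n. F n *v v) \<longlonglongrightarrow> L *v v"
      using F unfolding tendsto_matrix_entries
      by (auto simp: matrix_vector_mult_def intro!: vec_tendstoI tendsto_sum tendsto_mult)
    then show "(\<lambda>n. v \<bullet> (F n *v v)) \<longlonglongrightarrow> v \<bullet> (L *v v)" by (intro tendsto_intros)
    show "\<exists>N. \<forall>n\<ge>N. 0 \<le> v \<bullet> (F n *v v)" using p by (auto simp: psd_iff)
  qed
  ultimately show ?thesis by (simp add: psd_iff)
qed

text \<open>Monotone convergence for matrices: the quadratic forms converge as bounded monotone real
sequences, and polarization recovers the real and imaginary part of each entry from them.\<close>

lemma psd_mono_bounded_converges:
  fixes Y :: "nat \<Rightarrow> complex^'l^'l"
  assumes herm: "\<And>n. adj (Y n) = Y n"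
    and inc: "\<And>n. psd (Y (Suc n) - Y n)" and bound: "\<And>n. psd (mat 1 - Y n)"
  obtains L where "Y \<longlonglongrightarrow> L"
proof -
  have conv: "convergent (\<lambda>n. v \<bullet> (Y n *v v))" for v
  proof -
    have "incseq (\<lambda>n. v \<bullet> (Y n *v v))"
      using inc by (intro incseq_SucI) (simp add: psd_iff inner_diff_right matrix_vector_mult_diff_rdistrib)
    moreover have "\<forall>n. v \<bullet> (Y n *v v) \<le> v \<bullet> v"
      using bound by (simp add: psd_iff inner_diff_right matrix_vector_mult_diff_rdistrib)
    ultimately show ?thesis by (meson incseq_convergent convergentI)
  qed
  have pol: "v \<bullet> (Y n *v w) =
      ((v + w) \<bullet> (Y n *v (v + w)) - v \<bullet> (Y n *v v) - w \<bullet> (Y n *v w)) / 2" for v w n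
    using inner_adj[of w "Y n" v] herm[of n]
    by (simp add: inner_add_left inner_add_right matrix_vector_right_distrib inner_commute)
  have "convergent (\<lambda>n. v \<bullet> (Y n *v w))" for v w
  proof -
    have "convergent (\<lambda>n. ((v + w) \<bullet> (Y n *v (v + w)) - v \<bullet> (Y n *v v) - w \<bullet> (Y n *v w)) / 2)"
      unfolding divide_inverse
      by (intro convergent_mult convergent_diff convergent_const conv)
    then show ?thesis by (simp only: pol[of v _ w, symmetric])
  qed
  then have c: "\<exists>l. (\<lambda>n. v \<bullet> (Y n *v w)) \<longlonglongrightarrow> l" for v w by (simp add: convergent_def)
  have e: "axis i c \<bullet> (Y n *v axis j 1) = Re (cnj c * Y n $ i $ j)" for i j c n
  proof -
    have "(Y n *v axis j 1) $ i = Y n $ i $ j"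
      by (simp add: matrix_vector_mult_def axis_def if_distrib[of "(*) _"] cong: if_cong)
    then show ?thesis by (simp add: inner_axis' inner_complex_def)
  qed
  have "\<exists>l. (\<lambda>n. Y n $ i $ j) \<longlonglongrightarrow> l" for i j
  proof -
    obtain a b where "(\<lambda>n. Re (Y n $ i $ j)) \<longlonglongrightarrow> a" "(\<lambda>n. Im (Y n $ i $ j)) \<longlonglongrightarrow> b"
      using c[of "axis i 1" "axis j 1"] c[of "axis i \<i>" "axis j 1"] by (auto simp: e)
    then have "(\<lambda>n. Y n $ i $ j) \<longlonglongrightarrow> Complex a b" by (simp add: tendsto_complex_iff)
    then show ?thesis by blast
  qed
  then obtain l where "\<And>i j. (\<lambda>n. Y n $ i $ j) \<longlonglongrightarrow> l i j" by metis
  then have "Y \<longlonglongrightarrow> (\<chi> i j. l i j)" by (simp add: tendsto_matrix_entries)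
  then show ?thesis by (rule that)
qed

primrec mat_power :: "complex^'l^'l \<Rightarrow> nat \<Rightarrow> complex^'l^'l" where
  "mat_power X 0 = mat 1"
| "mat_power X (Suc n) = X ** mat_power X n"

lemma mat_power_add: "mat_power X (m + n) = mat_power X m ** mat_power X n"
  by (induction m) (simp_all add: matrix_mul_assoc)

lemma mat_power_commute: "C ** X = X ** C \<Longrightarrow> C ** mat_power X n = mat_power X n ** C"
  by (induction n) (simp_all, metis matrix_mul_assoc)

lemma psd_mat_power: "psd X \<Longrightarrow> psd (mat_power X n)"
proof (induction n rule: less_induct)
  case (less n)
  consider "n = 0" | "n = 1" | m where "n = Suc (Suc m)"
    by (metis One_nat_def not0_implies_Suc)
  then show ?case
  proof cases
    case 3
    have "mat_power X n = adj X ** mat_power X m ** X"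
      using less.prems mat_power_commute[of X X m]
      by (simp add: 3 psd_hermitian) (metis matrix_mul_assoc)
    then show ?thesis using less 3 by (auto intro: psd_congruence)
  qed (use less.prems posdef_imp_psd[OF posdef_mat1] in auto)
qed

text \<open>The values at \<open>X\<close> of the real polynomials with non-negative coefficients. For positive
semi-definite \<open>X\<close> they are all positive semi-definite, and they are closed under multiplication,
which makes the iteration below monotone.\<close>

inductive_set nonneg_polys :: "complex^'l^'l \<Rightarrow> (complex^'l^'l) set" for X where
  power: "mat_power X n \<in> nonneg_polys X"
| add: "M \<in> nonneg_polys X \<Longrightarrow> N \<in> nonneg_polys X \<Longrightarrow> M + N \<in> nonneg_polys X"
| scale: "M \<in> nonneg_polys X \<Longrightarrow> 0 \<le> r \<Longrightarrow> r *\<^sub>R M \<in> nonneg_polys X"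

lemma nonneg_polys_mult:
  assumes "M \<in> nonneg_polys X" "N \<in> nonneg_polys X"
  shows "M ** N \<in> nonneg_polys X"
  using assms
proof (induction M)
  case (power n)
  from power.prems show ?case
    by induction (auto simp: mat_power_add[symmetric] matrix_ring_simps intro: nonneg_polys.intros)
qed (auto simp: matrix_ring_simps intro: nonneg_polys.intros)

lemma nonneg_polys_commute:
  "M \<in> nonneg_polys X \<Longrightarrow> C ** X = X ** C \<Longrightarrow> C ** M = M ** C"
  by (induction rule: nonneg_polys.induct) (auto simp: matrix_ring_simps mat_power_commute)

lemma nonneg_polys_psd: "M \<in> nonneg_polys X \<Longrightarrow> psd X \<Longrightarrow> psd M"
  by (induction rule: nonneg_polys.induct) (auto intro: psd_mat_power psd_add psd_scaleR)

text \<open>For \<open>A = 1 - X\<close> the square root is sought as \<open>1 - Y\<close>; the equation \<open>(1 - Y)\<^sup>2 = 1 - X\<close> is the fixed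
point equation \<open>Y = (X + Y\<^sup>2) / 2\<close>, which is solved by iteration from \<open>0\<close>.\<close>

primrec sqrt_iter :: "complex^'l^'l \<Rightarrow> nat \<Rightarrow> complex^'l^'l" where
  "sqrt_iter X 0 = 0"
| "sqrt_iter X (Suc n) = (1/2) *\<^sub>R (X + sqrt_iter X n ** sqrt_iter X n)"

lemma sqrt_iter_nonneg_poly: "sqrt_iter X n \<in> nonneg_polys X"
proof (induction n)
  case 0
  show ?case using nonneg_polys.scale[OF nonneg_polys.power[of X 0], of 0] by simp
next
  case (Suc n)
  have "X \<in> nonneg_polys X" using nonneg_polys.power[of X 1] by simp
  then show ?case using Suc by (auto intro!: nonneg_polys.scale nonneg_polys.add nonneg_polys_mult)
qed

lemma sqrt_iter_commute: "sqrt_iter X m ** sqrt_iter X n = sqrt_iter X n ** sqrt_iter X m"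
  by (metis nonneg_polys_commute sqrt_iter_nonneg_poly)

text \<open>Since the iterates commute, the increment is half of
\<open>(Y\<^bsub>n+1\<^esub> - Y\<^bsub>n\<^esub>) (Y\<^bsub>n+1\<^esub> + Y\<^bsub>n\<^esub>)\<close>, again a polynomial in \<open>X\<close> with non-negative coefficients.\<close>

lemma sqrt_iter_increasing: "sqrt_iter X (Suc n) - sqrt_iter X n \<in> nonneg_polys X"
proof (induction n)
  case 0
  show ?case using nonneg_polys.scale[OF nonneg_polys.power[of X 1], of "1/2"] by simp
next
  case (Suc n)
  let ?a = "sqrt_iter X (Suc n)" and ?b = "sqrt_iter X n"
  have "sqrt_iter X (Suc (Suc n)) - ?a = (1/2) *\<^sub>R (?a ** ?a - ?b ** ?b)"
    by (simp add: algebra_simps)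
  also have "?a ** ?a - ?b ** ?b = (?a - ?b) ** (?a + ?b)"
    using sqrt_iter_commute[of X "Suc n" n] by (simp add: matrix_ring_simps del: sqrt_iter.simps)
  finally show ?case
    using Suc sqrt_iter_nonneg_poly
    by (metis nonneg_polys.add nonneg_polys.scale nonneg_polys_mult zero_le_divide_1_iff zero_le_numeral)
qed

text \<open>The bound \<open>Y \<le> 1\<close> passes to \<open>Y\<^sup>2\<close> because \<open>Y - Y\<^sup>2 = Y (1 - Y) Y + (1 - Y) Y (1 - Y)\<close> is a sum of two
congruences of positive semi-definite matrices.\<close>

lemma sqrt_iter_bounded:
  assumes "psd X" "psd (mat 1 - X)"
  shows "psd (mat 1 - sqrt_iter X n)"
proof (induction n)
  case 0
  show ?case by (simp add: posdef_imp_psd posdef_mat1)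
next
  case (Suc n)
  define Y where "Y = sqrt_iter X n"
  have Y: "psd Y" "psd (mat 1 - Y)"
    using Suc assms(1) nonneg_polys_psd sqrt_iter_nonneg_poly unfolding Y_def by blast+
  have h: "adj Y = Y" using Y(1) by (rule psd_hermitian)
  have "psd (adj Y ** (mat 1 - Y) ** Y)" "psd (adj (mat 1 - Y) ** Y ** (mat 1 - Y))"
    using Y by (simp_all only: psd_congruence)
  then have "psd ((1/2) *\<^sub>R ((mat 1 - X) + ((mat 1 - Y) +
      (adj Y ** (mat 1 - Y) ** Y + adj (mat 1 - Y) ** Y ** (mat 1 - Y)))))"
    using Y(2) assms(2) by (intro psd_scaleR psd_add) simp_all
  also have "(1/2) *\<^sub>R ((mat 1 - X) + ((mat 1 - Y) +
      (adj Y ** (mat 1 - Y) ** Y + adj (mat 1 - Y) ** Y ** (mat 1 - Y)))) = 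
      (1/2) *\<^sub>R (mat 1 + mat 1) - (1/2) *\<^sub>R (X + Y ** Y)"
    by (simp add: adj_simps h matrix_ring_simps algebra_simps matrix_mul_assoc)
  also have "(1/2::real) *\<^sub>R (mat 1 + mat 1) = (mat 1 :: complex^'a^'a)"
    by (simp add: scaleR_add_right[symmetric] scaleR_2[symmetric] del: scaleR_add_right)
  finally show ?case by (simp add: Y_def)
qed

text \<open>The iterates are polynomials in \<open>X\<close>, so their limit commutes with everything that commutes with
\<open>A\<close>. This commutation property yields uniqueness and is used for the square roots of
\<open>1 - \<alpha>\<close>, \<open>1 + \<alpha>\<close> and \<open>1 - \<alpha>\<^sup>2\<close>.\<close>

lemma psd_sqrt_of_contraction:
  assumes A: "psd A" "psd (mat 1 - A)"
  shows "\<exists>S. psd S \<and> S ** S = A \<and> (\<forall>C. C ** A = A ** C \<longrightarrow> C ** S = S ** C)"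
proof -
  define X where "X = mat 1 - A"
  have X: "psd X" "psd (mat 1 - X)" using A by (simp_all add: X_def)
  note np = sqrt_iter_nonneg_poly[of X]
  obtain L where L: "sqrt_iter X \<longlonglongrightarrow> L"
    using psd_mono_bounded_converges[of "sqrt_iter X"] nonneg_polys_psd[OF np X(1)]
      nonneg_polys_psd[OF sqrt_iter_increasing X(1)] sqrt_iter_bounded[OF X] psd_hermitian
    by metis
  have "(\<lambda>n. sqrt_iter X (Suc n)) \<longlonglongrightarrow> (1/2) *\<^sub>R (X + L ** L)"
    using L by (auto intro!: tendsto_intros tendsto_matrix_mult)
  then have fixp: "L = (1/2) *\<^sub>R (X + L ** L)"
    using LIMSEQ_Suc[OF L] LIMSEQ_unique by blast
  have "L + L = X + L ** L"
    by (subst (1 2) fixp) (simp add: scaleR_add_left[symmetric])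
  then have sq: "(mat 1 - L) ** (mat 1 - L) = A"
    by (simp add: matrix_ring_simps X_def algebra_simps)
  have "psd (mat 1 - L)"
    by (rule psd_limit[OF tendsto_diff[OF tendsto_const L]]) (rule sqrt_iter_bounded[OF X])
  moreover have "C ** (mat 1 - L) = (mat 1 - L) ** C" if C: "C ** A = A ** C" for C
  proof -
    have "C ** X = X ** C" using C by (simp add: X_def matrix_ring_simps)
    then have "C ** sqrt_iter X n = sqrt_iter X n ** C" for n
      using nonneg_polys_commute np by blast
    then have "C ** L = L ** C"
      using tendsto_matrix_mult[OF tendsto_const L, of C] tendsto_matrix_mult[OF L tendsto_const, of C]
      by (simp add: LIMSEQ_unique)
    then show ?thesis by (simp add: matrix_ring_simps)
  qed
  ultimately show ?thesis using sq by blast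
qed

lemma psd_sqrt_exists:
  assumes A: "psd A"
  shows "\<exists>S. psd S \<and> S ** S = A \<and> (\<forall>C. C ** A = A ** C \<longrightarrow> C ** S = S ** C)"
proof -
  obtain K where K: "K > 0" "\<And>v. norm (A *v v) \<le> norm v * K"
    using bounded_linear.pos_bounded[OF matrix_vector_mul_bounded_linear[of A]] by blast
  define A' where "A' = (1/K) *\<^sub>R A"
  have bound: "v \<bullet> (A *v v) \<le> K * (v \<bullet> v)" for v
  proof -
    have "v \<bullet> (A *v v) \<le> norm v * norm (A *v v)" by (rule norm_cauchy_schwarz)
    also have "\<dots> \<le> norm v * (norm v * K)" by (intro mult_left_mono K) auto
    finally show ?thesis by (simp add: dot_square_norm power2_eq_square mult_ac)
  qed
  have "psd A'" using A K by (simp add: A'_def psd_scaleR)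
  moreover have "psd (mat 1 - A')"
    using A K bound unfolding psd_iff A'_def
    by (simp add: adj_simps matrix_vector_mult_diff_rdistrib matrix_vector_scaleR inner_diff_right
        divide_simps mult.commute)
  ultimately obtain S where S: "psd S" "S ** S = A'" "\<And>C. C ** A' = A' ** C \<Longrightarrow> C ** S = S ** C"
    using psd_sqrt_of_contraction by blast
  define T where "T = sqrt K *\<^sub>R S"
  have "psd T" using S(1) K by (simp add: T_def psd_scaleR)
  moreover have "T ** T = A" using S(2) K by (simp add: T_def matrix_ring_simps A'_def)
  moreover have "C ** T = T ** C" if "C ** A = A ** C" for C
    using S(3)[of C] that by (simp add: T_def A'_def matrix_ring_simps)
  ultimately show ?thesis by blast
qed

text \<open>Two arbitrary roots need not be known to commute, but each commutes with the root that is a limit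
of polynomials in the matrix, and so both are equal to it.\<close>

lemma psd_sqrt_unique:
  assumes "psd S" "psd B" "S ** S = B ** B"
  shows "S = B"
proof -
  obtain Q where Q: "psd Q" "Q ** Q = S ** S" "\<And>C. C ** (S ** S) = (S ** S) ** C \<Longrightarrow> C ** Q = Q ** C"
    using psd_sqrt_exists[OF psd_square[OF psd_hermitian[OF assms(1)]]] by blast
  have "S ** Q = Q ** S" "B ** Q = Q ** B"
    using Q(3)[of S] Q(3)[of B] assms(3) by (simp_all add: matrix_mul_assoc) (metis matrix_mul_assoc)
  then have "Q = S" "Q = B"
    using psd_sqrt_unique_of_commuting Q(1,2) assms by metis+
  then show ?thesis by simp
qed

lemma mat_sqrt_eqI: "psd B \<Longrightarrow> B ** B = A \<Longrightarrow> mat_sqrt A = B"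
  unfolding mat_sqrt_def by (rule the_equality) (auto intro: psd_sqrt_unique)

lemma
  assumes "psd A"
  shows mat_sqrt_psd: "psd (mat_sqrt A)" and mat_sqrt_square: "mat_sqrt A ** mat_sqrt A = A"
    and mat_sqrt_commute: "C ** A = A ** C \<Longrightarrow> C ** mat_sqrt A = mat_sqrt A ** C"
proof -
  obtain S where S: "psd S" "S ** S = A" "\<And>C. C ** A = A ** C \<Longrightarrow> C ** S = S ** C"
    using psd_sqrt_exists[OF assms] by blast
  have "mat_sqrt A = S" using mat_sqrt_eqI[OF S(1,2)] by simp
  then show "psd (mat_sqrt A)" "mat_sqrt A ** mat_sqrt A = A"
    "C ** A = A ** C \<Longrightarrow> C ** mat_sqrt A = mat_sqrt A ** C" using S(1,2) S(3)[of C] by simp_all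
qed

lemma mat_sqrt_hermitian: "psd A \<Longrightarrow> adj (mat_sqrt A) = mat_sqrt A"
  by (intro psd_hermitian mat_sqrt_psd)

text \<open>If \<open>A\<close> and \<open>B\<close> commute then \<open>A B\<close> is the congruence of \<open>B\<close> by the square root of \<open>A\<close>.\<close>

lemma psd_mult_commuting:
  assumes "psd A" "psd B" "A ** B = B ** A"
  shows "psd (A ** B)"
proof -
  have "B ** mat_sqrt A = mat_sqrt A ** B" using mat_sqrt_commute assms by metis
  then have "A ** B = adj (mat_sqrt A) ** B ** mat_sqrt A"
    using mat_sqrt_square[OF assms(1)] mat_sqrt_hermitian[OF assms(1)]
    by (metis matrix_mul_assoc)
  then show ?thesis using psd_congruence[OF assms(2)] by simp
qed

lemma posdef_inverse:
  assumes "posdef A"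
  obtains B where "A ** B = mat 1" "B ** A = mat 1" "posdef B"
proof -
  have "A *v v = 0 \<Longrightarrow> v = 0" for v
    using assms unfolding posdef_iff by (metis inner_zero_right less_irrefl)
  then obtain B where B: "B ** A = mat 1"
    using matrix_left_invertible_ker by blast
  then have AB: "A ** B = mat 1" by (simp add: matrix_left_right_inverse)
  have hA: "adj A = A" using assms by (rule posdef_hermitian)
  have "adj B ** A = mat 1" using arg_cong[OF AB, of adj] hA by (simp add: adj_simps)
  then have hB: "adj B = B" by (metis AB matrix_mul_assoc matrix_mul_lid matrix_mul_rid)
  have "0 < v \<bullet> (B *v v)" if "v \<noteq> 0" for v
  proof -
    have "A *v (B *v v) = v" by (simp add: matrix_vector_mul_assoc AB)
    then have "v \<bullet> (B *v v) = (B *v v) \<bullet> (A *v (B *v v))" "B *v v \<noteq> 0"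
      using that by (auto simp: inner_commute)
    then show ?thesis using assms by (simp add: posdef_iff)
  qed
  then show ?thesis using that AB B hB by (simp add: posdef_iff)
qed

lemma matrix_inv_eq:
  fixes A :: "complex^'l^'l"
  assumes "A ** B = mat 1"
  shows "matrix_inv A = B"
proof -
  have BA: "B ** A = mat 1" using assms by (simp add: matrix_left_right_inverse)
  have "A ** matrix_inv A = mat 1 \<and> matrix_inv A ** A = mat 1"
    unfolding matrix_inv_def by (rule someI[of _ B]) (use assms BA in auto)
  then show ?thesis using BA by (metis matrix_mul_assoc matrix_mul_lid matrix_mul_rid)
qed

section \<open>Integrals over the circle\<close>

lemma sets_scalar_measure [simp]: "sets (scalar_measure A \<mu> v) = sets A"
  and space_scalar_measure [simp]: "space (scalar_measure A \<mu> v) = space A"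
  by (simp_all add: scalar_measure_def)

lemma finite_scalar_measure: "matrix_measure A \<mu> \<Longrightarrow> finite_measure (scalar_measure A \<mu> v)"
  by (rule finite_measureI) (simp add: emeasure_scalar_measure)

text \<open>The polarization vectors for the entry \<open>(j, i)\<close> are unimodular multiples of those for \<open>(i, j)\<close>; this
is what makes the entries of the matrix measure Hermitian.\<close>

lemma scalar_measure_unimodular:
  assumes "cmod c = 1"
  shows "scalar_measure A \<mu> (c *s v) = scalar_measure A \<mu> v"
proof -
  have c: "cnj c * c = 1" using assms by (metis complex_norm_square mult.commute of_real_1 power_one)
  have "M *v (c *s v) = c *s (M *v v)" for M :: "complex^'b^'b"
    by (simp add: vec_eq_iff matrix_vector_mult_def sum_distrib_left mult_ac)
  then have "cinner (c *s v) (M *v (c *s v)) = cinner v (M *v v)" for M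
    using c by (simp add: cinner_def) (simp add: mult.assoc[symmetric] mult.commute mult.left_commute)
  then show ?thesis by (simp add: scalar_measure_def)
qed

lemma circle_space [simp]: "space circle = sphere 0 1"
  by (simp add: space_restrict_space)

lemma circle_integrable:
  assumes mm: "matrix_measure circle \<mu>" and h: "continuous_on (sphere 0 1) h"
  shows "integrable (scalar_measure circle \<mu> v) (h :: complex \<Rightarrow> complex)"
proof -
  interpret finite_measure "scalar_measure circle \<mu> v" by (rule finite_scalar_measure[OF mm])
  have "bounded (h ` sphere 0 1)"
    using compact_continuous_image[OF h compact_sphere] by (rule compact_imp_bounded)
  then obtain K where K: "\<And>z. z \<in> sphere 0 1 \<Longrightarrow> norm (h z) \<le> K"
    unfolding bounded_iff by fast
  show ?thesis
  proof (rule integrable_const_bound)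
    show "AE z in scalar_measure circle \<mu> v. norm (h z) \<le> K" using K by (intro AE_I2) auto
    show "h \<in> borel_measurable (scalar_measure circle \<mu> v)"
      using borel_measurable_continuous_on_restrict[OF h] measurable_cong_sets[OF sets_scalar_measure refl]
      by blast
  qed
qed

lemma entry_integral_cong:
  "(\<And>x. x \<in> space A \<Longrightarrow> h x = h' x) \<Longrightarrow> entry_integral A \<mu> i j h = entry_integral A \<mu> i j h'"
  unfolding entry_integral_def
  by (intro arg_cong2[of _ _ _ _ "(/)"] sum.cong refl arg_cong2[of _ _ _ _ "(*)"] Bochner_Integration.integral_cong) auto

lemma entry_integral_cmult: "entry_integral A \<mu> i j (\<lambda>x. c * h x) = c * entry_integral A \<mu> i j h"
  by (simp add: entry_integral_def sum_distrib_left mult_ac)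

lemma entry_integral_cnj: "cnj (entry_integral A \<mu> i j h) = entry_integral A \<mu> j i (\<lambda>x. cnj (h x))"
proof -
  let ?I = "\<lambda>v. LINT x|scalar_measure A \<mu> v. cnj (h x)"
  have s: "scalar_measure A \<mu> (axis j 1 + axis i c) = scalar_measure A \<mu> (axis i 1 + axis j (cnj c))"
    if "cmod c = 1" for c
  proof -
    have "c * cnj c = 1" using that by (metis complex_norm_square of_real_1 power_one)
    then have "axis j 1 + axis i c = c *s (axis i 1 + axis j (cnj c))"
      by (auto simp: vec_eq_iff axis_def)
    then show ?thesis using scalar_measure_unimodular[OF that] by metis
  qed
  have l: "cnj (entry_integral A \<mu> i j h) = (\<Sum>k<4. \<i> ^ k * ?I (axis i 1 + axis j (\<i> ^ k))) / 4"
    by (simp add: entry_integral_def)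
  have r: "entry_integral A \<mu> j i (\<lambda>x. cnj (h x)) =
      (\<Sum>k<4. (-\<i>) ^ k * ?I (axis i 1 + axis j (cnj (\<i> ^ k)))) / 4"
    unfolding entry_integral_def by (simp only: s norm_power norm_ii power_one)
  show ?thesis
    unfolding l r by (simp add: eval_nat_numeral lessThan_Suc algebra_simps)
qed

lemma entry_integral_add:
  assumes "matrix_measure circle \<mu>" "continuous_on (sphere 0 1) g" "continuous_on (sphere 0 1) h"
  shows "entry_integral circle \<mu> i j (\<lambda>z. g z + h z) =
    entry_integral circle \<mu> i j g + entry_integral circle \<mu> i j h"
  using circle_integrable[OF assms(1,2)] circle_integrable[OF assms(1,3)]
  by (simp add: entry_integral_def distrib_left sum.distrib add_divide_distrib)

lemma entry_integral_sum:
  assumes "matrix_measure circle \<mu>" "finite K" "\<And>k. k \<in> K \<Longrightarrow> continuous_on (sphere 0 1) (g k)"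
  shows "entry_integral circle \<mu> i j (\<lambda>z. \<Sum>k\<in>K. g k z) = (\<Sum>k\<in>K. entry_integral circle \<mu> i j (g k))"
  using assms(2,3)
proof (induction K rule: finite_induct)
  case empty
  show ?case by (simp add: entry_integral_def)
next
  case (insert k K)
  then show ?case
    using entry_integral_add[OF assms(1), of "g k" "\<lambda>z. \<Sum>k\<in>K. g k z" i j]
    by (simp add: continuous_on_sum)
qed

text \<open>Invariance of the measure under conjugation is invariance of each scalar measure \<open>v\<^sup>\<dagger> \<mu> v\<close> under
push-forward by \<open>cnj\<close>.\<close>

lemma entry_integral_flip:
  assumes mm: "matrix_measure circle \<mu>" and ci: "conj_invariant \<mu>"
    and h: "continuous_on (sphere 0 1) h"
  shows "entry_integral circle \<mu> i j (\<lambda>z. h (cnj z)) = entry_integral circle \<mu> i j h"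
proof -
  have meas: "cnj \<in> measurable circle circle"
    by (intro measurable_restrict_space3) (auto intro!: borel_measurable_continuous_onI continuous_intros)
  have meas': "cnj \<in> measurable (scalar_measure circle \<mu> v) circle" for v
    using meas measurable_cong_sets[OF sets_scalar_measure refl] by blast
  have d: "distr (scalar_measure circle \<mu> v) circle cnj = scalar_measure circle \<mu> v" for v
  proof (rule measure_eqI)
    fix X assume "X \<in> sets (distr (scalar_measure circle \<mu> v) circle cnj)"
    then have X: "X \<in> sets circle" by simp
    have sub: "X \<subseteq> sphere 0 1" using sets.sets_into_space[OF X] by simp
    have im: "cnj -` X \<inter> sphere 0 1 = cnj ` X"
    proof
      show "cnj -` X \<inter> sphere 0 1 \<subseteq> cnj ` X" by (auto intro: rev_image_eqI[of "cnj _"])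
      show "cnj ` X \<subseteq> cnj -` X \<inter> sphere 0 1" using sub by auto
    qed
    have X': "cnj ` X \<in> sets circle"
      using measurable_sets[OF meas X] im by simp
    have "\<mu> (cnj ` X) = \<mu> X" using ci X by (simp add: conj_invariant_def)
    then show "emeasure (distr (scalar_measure circle \<mu> v) circle cnj) X = emeasure (scalar_measure circle \<mu> v) X"
      using X X' im by (simp add: emeasure_distr[OF meas' X] emeasure_scalar_measure[OF mm])
  qed simp
  have "(LINT z|scalar_measure circle \<mu> v. h (cnj z)) = (LINT z|scalar_measure circle \<mu> v. h z)" for v
    using integral_distr[OF meas' borel_measurable_continuous_on_restrict[OF h], of v] d[of v] by simp
  then show ?thesis by (simp add: entry_integral_def)
qed

lemma entry_integral_one:
  assumes "matrix_measure circle \<mu>" "\<mu> (sphere 0 1) = mat 1"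
  shows "entry_integral circle \<mu> i j (\<lambda>_. 1) = mat 1 $ i $ j"
proof -
  have "sphere 0 1 \<in> sets circle" by (metis circle_space sets.top)
  then have "entry_integral circle \<mu> i j (indicator (sphere 0 1)) = mat 1 $ i $ j"
    using entry_integral_indicator[OF assms(1)] assms(2) by metis
  moreover have "entry_integral circle \<mu> i j (indicator (sphere 0 1)) = entry_integral circle \<mu> i j (\<lambda>_. 1)"
    by (rule entry_integral_cong) simp
  ultimately show ?thesis by simp
qed

text \<open>A class of integrands that is closed under matrix multiplication; integrability against any
matrix measure is automatic since the circle is compact.\<close>

definition circle_cont :: "(complex \<Rightarrow> complex^'l^'l) \<Rightarrow> bool" where
  "circle_cont f \<longleftrightarrow> (\<forall>i j. continuous_on (sphere 0 1) (\<lambda>z. f z $ i $ j))"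

lemma circle_cont_mult [intro]: "circle_cont f \<Longrightarrow> circle_cont g \<Longrightarrow> circle_cont (\<lambda>z. f z ** g z)"
  by (auto simp: circle_cont_def matrix_matrix_mult_def intro!: continuous_on_sum continuous_on_mult)

lemma circle_cont_add [intro]: "circle_cont f \<Longrightarrow> circle_cont g \<Longrightarrow> circle_cont (\<lambda>z. f z + g z)"
  by (simp add: circle_cont_def continuous_on_add)

lemma circle_cont_const [intro]: "circle_cont (\<lambda>z. C)"
  by (auto simp: circle_cont_def)

lemma circle_cont_mat [intro]: "continuous_on (sphere 0 1) h \<Longrightarrow> circle_cont (\<lambda>z. mat (h z))"
  unfolding circle_cont_def
proof (intro allI)
  fix i j :: 'a assume "continuous_on (sphere 0 1) h"
  then show "continuous_on (sphere 0 1) (\<lambda>z. (mat (h z) :: complex^'a^'a) $ i $ j)"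
    by (cases "i = j") (simp_all add: mat_def)
qed

lemma circle_cont_adj [intro]: "circle_cont f \<Longrightarrow> circle_cont (\<lambda>z. adj (f z))"
  by (auto simp: circle_cont_def adj_entry intro!: continuous_on_cnj)

lemma circle_cont_flip [intro]:
  assumes "circle_cont f"
  shows "circle_cont (\<lambda>z. f (cnj z))"
  unfolding circle_cont_def
proof (intro allI)
  fix i j
  have "continuous_on (cnj ` sphere 0 1) (\<lambda>z. f z $ i $ j)"
    by (rule continuous_on_subset[of "sphere 0 1"]) (use assms in \<open>auto simp: circle_cont_def\<close>)
  then show "continuous_on (sphere 0 1) (\<lambda>z. f (cnj z) $ i $ j)"
    by (rule continuous_on_compose2) (auto intro!: continuous_intros)
qed

lemma circle_cont_cong: "(\<And>z. z \<in> sphere 0 1 \<Longrightarrow> f z = g z) \<Longrightarrow> circle_cont f \<longleftrightarrow> circle_cont g"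
  unfolding circle_cont_def by (metis (no_types, lifting) continuous_on_cong)

lemma circle_cont_monomial [intro]: "circle_cont (\<lambda>z. mat (z powi j))"
  by (intro circle_cont_mat continuous_intros) auto

lemma circle_cont_id [intro]: "circle_cont (\<lambda>z. mat z)"
  by (intro circle_cont_mat continuous_intros)

text \<open>The form \<open>R f g = \<integral> f\<^sup>\<dagger> d\<mu> g\<close> is sesquilinear over matrices acting from the right. Left multiplication
by a constant matrix has no adjoint for it; only scalar functions may be moved from one argument to
the other (\<open>R_shift\<close>). The symmetry of \<open>\<mu>\<close> enters as invariance of the form
under \<open>f(z) \<mapsto> f(cnj z)\<close> (\<open>R_flip\<close>).\<close>

locale symmetric_circle_measure =
  fixes \<mu> :: "complex set \<Rightarrow> complex^'l^'l"
  assumes mm: "matrix_measure circle \<mu>"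
    and ci: "conj_invariant \<mu>"
    and normalized: "\<mu> (sphere 0 1) = mat 1"
begin

abbreviation "R \<equiv> inner_R \<mu>"

lemma R_entry: "R f g $ j $ k = (\<Sum>m\<in>UNIV. \<Sum>n\<in>UNIV.
    entry_integral circle \<mu> m n (\<lambda>z. cnj (f z $ m $ j) * g z $ n $ k))"
  by (simp add: inner_R_def mat_integral_def adj_entry)

lemma R_cong:
  assumes "\<And>z. z \<in> sphere 0 1 \<Longrightarrow> f z = f' z" "\<And>z. z \<in> sphere 0 1 \<Longrightarrow> g z = g' z"
  shows "R f g = R f' g'"
  unfolding vec_eq_iff R_entry using assms by (intro allI sum.cong refl entry_integral_cong) simp

lemma R_adj: "adj (R f g) = R g f"
proof -
  have "adj (R f g) $ j $ k = R g f $ j $ k" for j k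
    unfolding adj_entry R_entry cnj_sum entry_integral_cnj
    by (subst sum.swap) (simp add: mult.commute)
  then show ?thesis by (simp add: vec_eq_iff)
qed

lemma R_add_right:
  assumes "circle_cont f" "circle_cont g" "circle_cont h"
  shows "R f (\<lambda>z. g z + h z) = R f g + R f h"
proof -
  have c: "continuous_on (sphere 0 1) (\<lambda>z. cnj (f z $ m $ j) * g z $ n $ k)"
       "continuous_on (sphere 0 1) (\<lambda>z. cnj (f z $ m $ j) * h z $ n $ k)" for m n j k
    using assms by (auto simp: circle_cont_def intro!: continuous_on_mult continuous_on_cnj)
  show ?thesis
    by (simp add: vec_eq_iff R_entry distrib_left entry_integral_add[OF mm c] sum.distrib)
qed

lemma R_mult_right:
  assumes "circle_cont f" "circle_cont g"
  shows "R f (\<lambda>z. g z ** C) = R f g ** C"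
proof -
  have c: "continuous_on (sphere 0 1) (\<lambda>z. C $ p $ k * (cnj (f z $ m $ j) * g z $ n $ p))" for m n j k p
    using assms by (auto simp: circle_cont_def intro!: continuous_on_mult continuous_on_cnj continuous_on_const)
  have "R f (\<lambda>z. g z ** C) $ j $ k = (R f g ** C) $ j $ k" for j k
  proof -
    have "R f (\<lambda>z. g z ** C) $ j $ k = (\<Sum>m\<in>UNIV. \<Sum>n\<in>UNIV. entry_integral circle \<mu> m n
        (\<lambda>z. \<Sum>p\<in>UNIV. C $ p $ k * (cnj (f z $ m $ j) * g z $ n $ p)))"
      by (simp add: R_entry matrix_matrix_mult_def sum_distrib_left mult_ac)
    also have "\<dots> = (\<Sum>m\<in>UNIV. \<Sum>n\<in>UNIV. \<Sum>p\<in>UNIV. entry_integral circle \<mu> m n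
        (\<lambda>z. cnj (f z $ m $ j) * g z $ n $ p) * C $ p $ k)"
      unfolding entry_integral_sum[OF mm finite c] entry_integral_cmult by (simp only: mult.commute)
    also have "\<dots> = (\<Sum>m\<in>UNIV. \<Sum>p\<in>UNIV. \<Sum>n\<in>UNIV. entry_integral circle \<mu> m n
        (\<lambda>z. cnj (f z $ m $ j) * g z $ n $ p) * C $ p $ k)"
      by (intro sum.cong refl sum.swap)
    also have "\<dots> = (\<Sum>p\<in>UNIV. \<Sum>m\<in>UNIV. \<Sum>n\<in>UNIV. entry_integral circle \<mu> m n
        (\<lambda>z. cnj (f z $ m $ j) * g z $ n $ p) * C $ p $ k)"
      by (rule sum.swap)
    also have "\<dots> = (R f g ** C) $ j $ k"
      by (simp add: matrix_matrix_mult_def R_entry sum_distrib_right)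
    finally show ?thesis .
  qed
  then show ?thesis by (simp add: vec_eq_iff)
qed

lemma R_add_left:
  assumes "circle_cont f" "circle_cont g" "circle_cont h"
  shows "R (\<lambda>z. g z + h z) f = R g f + R h f"
  by (metis R_add_right[OF assms] R_adj adj_add)

lemma R_mult_left:
  assumes "circle_cont f" "circle_cont g"
  shows "R (\<lambda>z. g z ** C) f = adj C ** R g f"
  by (metis R_mult_right[OF assms] R_adj adj_mult)

lemma R_zero_left: "R (\<lambda>z. 0) f = 0"
  by (simp add: vec_eq_iff R_entry entry_integral_def)

lemma R_minus_right: "R f (\<lambda>z. - g z) = - R f g"
  by (simp add: vec_eq_iff R_entry sum_negf entry_integral_cmult[of _ _ _ _ "-1", simplified])

lemma R_diff_right:
  assumes "circle_cont f" "circle_cont g" "circle_cont h"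
  shows "R f (\<lambda>z. g z - h z) = R f g - R f h"
proof -
  have "circle_cont (\<lambda>z. - h z)" using assms by (simp add: circle_cont_def continuous_on_minus)
  then show ?thesis using R_add_right[OF assms(1,2), of "\<lambda>z. - h z"] by (simp add: R_minus_right)
qed

lemma R_shift: "R (\<lambda>z. mat (h z) ** f z) g = R f (\<lambda>z. mat (cnj (h z)) ** g z)"
  by (simp add: vec_eq_iff R_entry mult_ac)

lemma R_unimodular:
  assumes "\<And>z. z \<in> sphere 0 1 \<Longrightarrow> cmod (h z) = 1"
  shows "R (\<lambda>z. mat (h z) ** f z) (\<lambda>z. mat (h z) ** g z) = R f g"
  unfolding R_shift
proof (rule R_cong)
  fix z :: complex assume "z \<in> sphere 0 1"
  then have "cnj (h z) * h z = 1"
    using assms by (metis complex_norm_square mult.commute of_real_1 power_one)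
  then show "mat (cnj (h z)) ** (mat (h z) ** g z) = g z" by simp
qed simp

lemma R_flip:
  assumes "circle_cont f" "circle_cont g"
  shows "R (\<lambda>z. f (cnj z)) (\<lambda>z. g (cnj z)) = R f g"
proof -
  have c: "continuous_on (sphere 0 1) (\<lambda>z. cnj (f z $ m $ j) * g z $ n $ k)" for m n j k
    using assms by (auto simp: circle_cont_def intro!: continuous_on_mult continuous_on_cnj)
  show ?thesis by (simp add: vec_eq_iff R_entry entry_integral_flip[OF mm ci c])
qed

lemma R_one: "R (\<lambda>_. mat 1) (\<lambda>_. mat 1) = mat 1"
proof -
  have "R (\<lambda>_. mat 1) (\<lambda>_. mat 1) $ j $ k = mat 1 $ j $ k" for j k
  proof -
    have "entry_integral circle \<mu> m n (\<lambda>z. cnj (mat 1 $ m $ j) * mat 1 $ n $ k) =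
      (if n = k then if m = j then mat 1 $ j $ k else 0 else 0)" for m n
      using entry_integral_one[OF mm normalized, of m n]
        entry_integral_cmult[of circle \<mu> m n 0 "\<lambda>_. 1"] by (auto simp: mat_def)
    then show ?thesis by (simp add: R_entry)
  qed
  then show ?thesis by (simp add: vec_eq_iff)
qed

end

section \<open>Matrix Laurent polynomials on the circle\<close>

text \<open>\<open>laurent a b f\<close>: on the circle, \<open>f\<close> agrees with a Laurent polynomial with exponents between
\<open>a\<close> and \<open>b\<close> and matrix coefficients on the right. Only the values on the circle matter, where
\<open>cnj z = 1 / z\<close>, so that conjugating the argument reflects the range of exponents.\<close>

inductive laurent :: "int \<Rightarrow> int \<Rightarrow> (complex \<Rightarrow> complex^'l^'l) \<Rightarrow> bool" for a b where
  zero: "(\<And>z. z \<in> sphere 0 1 \<Longrightarrow> f z = 0) \<Longrightarrow> laurent a b f"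
| step: "laurent a b g \<Longrightarrow> a \<le> j \<Longrightarrow> j \<le> b \<Longrightarrow>
    (\<And>z. z \<in> sphere 0 1 \<Longrightarrow> f z = g z + mat (z powi j) ** C) \<Longrightarrow> laurent a b f"

lemma laurent_cong:
  assumes "laurent a b f" "\<And>z. z \<in> sphere 0 1 \<Longrightarrow> g z = f z"
  shows "laurent a b g"
  using assms(1)
proof cases
  case zero
  then show ?thesis using assms(2) by (auto intro: laurent.zero)
next
  case (step h j C)
  show ?thesis by (rule laurent.step[OF step(1-3)]) (use step(4) assms(2) in auto)
qed

lemma laurent_monomial: "a \<le> j \<Longrightarrow> j \<le> b \<Longrightarrow> laurent a b (\<lambda>z. mat (z powi j) ** C)"
  by (rule laurent.step[OF laurent.zero[of "\<lambda>_. 0"]]) auto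

lemma laurent_add: "laurent a b f \<Longrightarrow> laurent a b g \<Longrightarrow> laurent a b (\<lambda>z. f z + g z)"
proof (induction rule: laurent.induct)
  case (zero f)
  then show ?case by (auto intro: laurent_cong)
next
  case (step h j f C)
  show ?case
    by (rule laurent.step[OF step.IH[OF step.prems] step.hyps(2,3), where C = C])
      (simp add: step.hyps algebra_simps)
qed

lemma laurent_mult_right: "laurent a b f \<Longrightarrow> laurent a b (\<lambda>z. f z ** D)"
proof (induction rule: laurent.induct)
  case (zero f)
  then show ?case by (auto intro: laurent.zero)
next
  case (step h j f C)
  show ?case
    by (rule laurent.step[OF step.IH step.hyps(2,3), where C = "C ** D"])
      (simp add: step.hyps matrix_add_rdistrib matrix_mul_assoc)
qed

lemma laurent_sum:
  "finite K \<Longrightarrow> (\<And>k. k \<in> K \<Longrightarrow> laurent a b (f k)) \<Longrightarrow> laurent a b (\<lambda>z. \<Sum>k\<in>K. f k z)"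
  by (induction K rule: finite_induct) (auto intro: laurent.zero laurent_add)

lemma laurent_mono: "laurent a b f \<Longrightarrow> a' \<le> a \<Longrightarrow> b \<le> b' \<Longrightarrow> laurent a' b' f"
proof (induction rule: laurent.induct)
  case (zero f)
  then show ?case by (auto intro: laurent.zero)
next
  case (step h j f C)
  show ?case
    by (rule laurent.step[OF step.IH[OF step.prems], where C = C and j = j])
      (use step in auto)
qed

lemma laurent_shift:
  "laurent a b f \<Longrightarrow> laurent (a + m) (b + m) (\<lambda>z. mat (z powi m) ** f z)"
proof (induction rule: laurent.induct)
  case (zero f)
  then show ?case by (auto intro: laurent.zero)
next
  case (step h j f C)
  show ?case
  proof (rule laurent.step[OF step.IH, where C = C and j = "j + m"])
    fix z :: complex assume z: "z \<in> sphere 0 1"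
    then have "z \<noteq> 0" by auto
    then show "mat (z powi m) ** f z = mat (z powi m) ** h z + mat (z powi (j + m)) ** C"
      by (simp add: step.hyps(4)[OF z] matrix_add_ldistrib power_int_add mult.commute)
  qed (use step in auto)
qed

lemma circle_cnj_powi: "z \<in> sphere 0 1 \<Longrightarrow> cnj z powi j = z powi (- j)"
proof -
  assume z: "z \<in> sphere 0 1"
  then have "cnj z = inverse z"
    by (metis complex_norm_square inverse_unique of_real_1 power_one dist_0_norm mem_sphere)
  then show ?thesis by (simp add: power_int_minus power_int_inverse)
qed

lemma laurent_flip: "laurent a b f \<Longrightarrow> laurent (- b) (- a) (\<lambda>z. f (cnj z))"
proof (induction rule: laurent.induct)
  case (zero f)
  then show ?case by (auto intro: laurent.zero)
next
  case (step h j f C)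
  show ?case
  proof (rule laurent.step[OF step.IH, where C = C and j = "- j"])
    fix z :: complex assume z: "z \<in> sphere 0 1"
    then have "cnj z \<in> sphere 0 1" by simp
    then show "f (cnj z) = h (cnj z) + mat (z powi - j) ** C"
      using step.hyps(4) circle_cnj_powi[OF z] by metis
  qed (use step in auto)
qed

lemma laurent_cont: "laurent a b f \<Longrightarrow> circle_cont f"
proof (induction rule: laurent.induct)
  case (zero f)
  then show ?case using circle_cont_cong[of f "\<lambda>_. 0"] by auto
next
  case (step h j f C)
  have "circle_cont (\<lambda>z. h z + mat (z powi j) ** C)"
    by (intro circle_cont_add circle_cont_mult circle_cont_monomial circle_cont_const step.IH)
  then show ?case using circle_cont_cong[of f "\<lambda>z. h z + mat (z powi j) ** C"] step.hyps(4) by auto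
qed

context symmetric_circle_measure
begin

lemma R_laurent_zero:
  assumes "laurent a b f" "circle_cont g" "\<And>j. a \<le> j \<Longrightarrow> j \<le> b \<Longrightarrow> R (\<lambda>z. mat (z powi j)) g = 0"
  shows "R f g = 0"
  using assms(1)
proof (induction rule: laurent.induct)
  case (zero f)
  then have "R f g = R (\<lambda>_. 0) g" by (intro R_cong) auto
  then show ?case by (simp add: R_zero_left)
next
  case (step h j f C)
  have "R f g = R (\<lambda>z. h z + mat (z powi j) ** C) g" using step.hyps(4) by (intro R_cong) auto
  also have "\<dots> = R h g + adj C ** R (\<lambda>z. mat (z powi j)) g"
    using laurent_cont[OF step.hyps(1)] assms(2)
    by (subst R_add_left) (auto simp: R_mult_left circle_cont_monomial)
  also have "\<dots> = 0" using step.IH step.hyps(2,3) assms(3) by simp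
  finally show ?case .
qed

end

section \<open>Matrix polynomials\<close>

lemma matrix_sum_ldistrib: "A ** (\<Sum>k\<in>K. f k) = (\<Sum>k\<in>K. A ** (f k :: complex^'l^'l))"
  by (induction K rule: infinite_finite_induct) (simp_all add: matrix_add_ldistrib)

lemma matrix_sum_rdistrib: "(\<Sum>k\<in>K. f k) ** A = (\<Sum>k\<in>K. (f k :: complex^'l^'l) ** A)"
  by (induction K rule: infinite_finite_induct) (simp_all add: matrix_add_rdistrib)

lemma degree_map_poly_le:
  assumes "f 0 = 0"
  shows "degree (map_poly f p) \<le> degree p"
  by (rule degree_le) (simp add: coeff_map_poly[of f, OF assms] coeff_eq_0 assms)

lemma mp_eval_upto:
  assumes "degree p \<le> N"
  shows "mp_eval p z = (\<Sum>k\<le>N. mat (z ^ k) ** coeff p k)"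
  unfolding mp_eval_def
  by (rule sum.mono_neutral_left) (use assms in \<open>auto simp: coeff_eq_0\<close>)

lemma mp_eval_add: "mp_eval (p + q) z = mp_eval p z + mp_eval q z"
  using mp_eval_upto[of "p + q" "max (degree p) (degree q)" z] degree_add_le_max[of p q]
    mp_eval_upto[of p "max (degree p) (degree q)" z] mp_eval_upto[of q "max (degree p) (degree q)" z]
  by (simp add: matrix_add_ldistrib sum.distrib)

lemma mp_eval_diff: "mp_eval (p - q) z = mp_eval p z - mp_eval q z"
  using mp_eval_upto[of "p - q" "max (degree p) (degree q)" z] degree_diff_le_max[of p q]
    mp_eval_upto[of p "max (degree p) (degree q)" z] mp_eval_upto[of q "max (degree p) (degree q)" z]
  by (simp add: matrix_diff_ldistrib sum_subtractf)

lemma mp_eval_const [simp]: "mp_eval [:C:] z = C"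
  by (simp add: mp_eval_def)

lemma mp_eval_shift: "mp_eval (pCons 0 p) z = mat z ** mp_eval p z"
proof -
  have "mp_eval (pCons 0 p) z = (\<Sum>k\<le>Suc (degree p). mat (z ^ k) ** coeff (pCons 0 p) k)"
    by (rule mp_eval_upto) (rule degree_pCons_le)
  also have "\<dots> = (\<Sum>k\<le>degree p. mat z ** (mat (z ^ k) ** coeff p k))"
    by (subst sum.atMost_Suc_shift) simp
  also have "\<dots> = mat z ** mp_eval p z"
    by (simp add: mp_eval_def matrix_sum_ldistrib)
  finally show ?thesis .
qed

lemma mp_eval_mult_right: "mp_eval (map_poly (\<lambda>C. C ** D) p) z = mp_eval p z ** D"
proof -
  have "mp_eval p z ** D = (\<Sum>k\<le>degree p. mat (z ^ k) ** coeff p k ** D)"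
    by (simp add: mp_eval_def matrix_sum_rdistrib)
  also have "\<dots> = mp_eval (map_poly (\<lambda>C. C ** D) p) z"
    by (subst mp_eval_upto[OF degree_map_poly_le]) (simp_all add: coeff_map_poly matrix_mul_assoc)
  finally show ?thesis by simp
qed

lemma mp_eval_adj: "mp_eval (map_poly adj p) z = adj (mp_eval p (cnj z))"
proof -
  have "adj (\<Sum>k\<le>N. mat (cnj z ^ k) ** coeff p k) = (\<Sum>k\<le>N. mat (z ^ k) ** adj (coeff p k))" for N
    by (induction N) (simp_all add: adj_simps mat_commute)
  then show ?thesis
    by (subst mp_eval_upto[OF degree_map_poly_le]) (simp_all add: coeff_map_poly mp_eval_def)
qed

lemma laurent_mp_eval:
  assumes "\<And>k. coeff p k \<noteq> 0 \<Longrightarrow> k < n"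
  shows "laurent 0 (int n - 1) (mp_eval p)"
proof -
  have "laurent 0 (int n - 1) (\<lambda>z. \<Sum>k\<le>degree p. mat (z ^ k) ** coeff p k)"
  proof (rule laurent_sum)
    fix k
    show "laurent 0 (int n - 1) (\<lambda>z. mat (z ^ k) ** coeff p k)"
    proof (cases "coeff p k = 0")
      case True
      then show ?thesis by (auto intro: laurent.zero)
    next
      case False
      then show ?thesis using assms[of k] laurent_monomial[of 0 "int k" "int n - 1" "coeff p k"] by auto
    qed
  qed simp
  then show ?thesis by (simp add: mp_eval_def[abs_def])
qed

lemma laurent_mp_eval_degree: "degree p \<le> n \<Longrightarrow> laurent 0 (int n) (mp_eval p)"
  using laurent_mp_eval[of p "Suc n"] le_degree le_less_Suc_eq by fastforce

text \<open>A positive definite \<open>P\<close> with \<open>P M P = 1\<close> has to be the inverse of the positive square root of \<open>M\<close>.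
This is why the normalization of the leading coefficients fixes them uniquely.\<close>

lemma posdef_eq_if_same_congruence:
  assumes P: "posdef P" and Q: "posdef Q" and PM: "P ** M ** P = mat 1" and QM: "Q ** M ** Q = mat 1"
  shows "P = Q"
proof -
  obtain P' where P': "P ** P' = mat 1" "P' ** P = mat 1" "posdef P'" using posdef_inverse[OF P] .
  obtain Q' where Q': "Q ** Q' = mat 1" "Q' ** Q = mat 1" "posdef Q'" using posdef_inverse[OF Q] .
  have eq: "M = X' ** X'" if "X' ** X = mat 1" "X ** X' = mat 1" "X ** M ** X = mat 1" for X X'
  proof -
    have "X' ** (X ** M ** X) ** X' = (X' ** X) ** M ** (X ** X')" by (simp add: matrix_mul_assoc)
    then show ?thesis using that by simp
  qed
  have "P' ** P' = Q' ** Q'"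
    using eq[OF P'(2,1) PM] eq[OF Q'(2,1) QM] by simp
  then have "P' = Q'" using P' Q' psd_sqrt_unique posdef_imp_psd by blast
  then show ?thesis by (metis P'(1) Q'(2) matrix_mul_assoc matrix_mul_lid matrix_mul_rid)
qed

section \<open>The Szego recursion of a symmetric measure\<close>

lemma inner_L_eq_inner_R: "inner_L \<mu> f g = inner_R \<mu> (\<lambda>z. adj (g z)) (\<lambda>z. adj (f z))"
  by (simp add: inner_L_def inner_R_def)

text \<open>The right orthonormal polynomials of a conjugation invariant measure, with their recursion. In
general the recursion also involves the left polynomials. By symmetry
\<open>\<phi>\<^sup>L(z) = \<phi>\<^sup>R(cnj z)\<^sup>\<dagger>\<close>, and hence the reversed left polynomial \<open>\<phi>\<^sup>L\<^sup>,\<^sup>*\<close> is \<open>z\<^sup>n \<phi>\<^sup>R(cnj z)\<close> on the circle,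
which leaves a recursion for \<open>\<phi>\<^sup>R\<close> alone.\<close>

locale symmetric_szego_recursion = symmetric_circle_measure \<mu>
  for \<mu> :: "complex set \<Rightarrow> complex^'l^'l" +
  fixes \<phi> :: "nat \<Rightarrow> complex \<Rightarrow> complex^'l^'l" and \<rho> a :: "nat \<Rightarrow> complex^'l^'l"
  assumes \<phi>_laurent: "laurent 0 (int n) (\<phi> n)"
    and \<phi>_orth: "0 \<le> j \<Longrightarrow> j < int n \<Longrightarrow> inner_R \<mu> (\<lambda>z. mat (z powi j)) (\<phi> n) = 0"
    and \<phi>_norm: "inner_R \<mu> (\<phi> n) (\<phi> n) = mat 1"
    and \<phi>_0: "z \<in> sphere 0 1 \<Longrightarrow> \<phi> 0 z = mat 1"
    and \<rho>_pos: "posdef (\<rho> n)"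
    and recursion: "z \<in> sphere 0 1 \<Longrightarrow>
      mat z ** \<phi> n z = \<phi> (Suc n) z ** \<rho> n + mat (z ^ n) ** \<phi> n (cnj z) ** a n"

context symmetric_circle_measure
begin

text \<open>The difference of the two polynomials has degree below \<open>n\<close> and is orthogonal to all such
polynomials, itself included, so non-triviality of the measure makes it vanish.\<close>

lemma monic_orthogonal_unique:
  assumes nt: "nontrivial \<mu>" and p: "mp_monic n p" and q: "mp_monic n q"
    and p_orth: "\<And>k. k < n \<Longrightarrow> R (\<lambda>z. mat (z ^ k)) (mp_eval p) = 0"
    and q_orth: "\<And>k. k < n \<Longrightarrow> R (\<lambda>z. mat (z ^ k)) (mp_eval q) = 0"
  shows "p = q"
proof -
  define d where "d = p - q"
  have cont: "circle_cont (mp_eval r)" for r :: "(complex^'l^'l) poly"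
    by (rule laurent_cont[OF laurent_mp_eval_degree[OF order_refl]])
  have d_eval: "mp_eval d = (\<lambda>z. mp_eval p z - mp_eval q z)"
    by (simp add: d_def fun_eq_iff mp_eval_diff)
  have "coeff d k \<noteq> 0 \<Longrightarrow> k < n" for k
    using p q unfolding d_def mp_monic_def
    by (cases k n rule: linorder_cases) (simp_all add: coeff_eq_0)
  then have "laurent 0 (int n - 1) (mp_eval d)" by (rule laurent_mp_eval)
  then have "R (mp_eval d) (mp_eval d) = 0"
  proof (rule R_laurent_zero[OF _ cont])
    fix j :: int assume "0 \<le> j" "j \<le> int n - 1"
    then obtain k where k: "j = int k" "k < n" using zero_le_imp_eq_int by force
    have "R (\<lambda>z. mat (z powi j)) (mp_eval d) = R (\<lambda>z. mat (z ^ k)) (mp_eval p) - R (\<lambda>z. mat (z ^ k)) (mp_eval q)"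
      unfolding d_eval k power_int_of_nat
      by (rule R_diff_right) (auto intro!: cont continuous_intros)
    then show "R (\<lambda>z. mat (z powi j)) (mp_eval d) = 0" using p_orth q_orth k by simp
  qed
  then have "\<not> 0 < Re (trace (R (mp_eval d) (mp_eval d)))" by (simp add: trace_def)
  then have "d = 0" using nt unfolding nontrivial_def by blast
  then show ?thesis by (simp add: d_def)
qed

text \<open>Everything here rests on \<open>\<Phi>\<^sup>L(z) = \<Phi>\<^sup>R(cnj z)\<^sup>\<dagger>\<close>, which follows from uniqueness of the monic orthogonal
polynomials, and on \<open>\<kappa>\<^sup>L = (\<kappa>\<^sup>R)\<^sup>\<dagger>\<close>, which follows from uniqueness of positive roots. The recursion that
defines the Verblunsky coefficients then becomes, after taking adjoints and conjugating \<open>z\<close>, the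
recursion for \<open>\<phi>\<^sup>R\<close>.\<close>

lemma symmetric_szego_recursion_of_verblunsky:
  assumes nt: "nontrivial \<mu>" and verb: "verblunsky \<mu> a"
  obtains \<phi> \<rho> where "symmetric_szego_recursion \<mu> \<phi> \<rho> a"
proof -
  obtain \<Phi>R \<Phi>L \<kappa>R \<kappa>L where data:
    "(\<forall>n. mp_monic n (\<Phi>R n) \<and> mp_monic n (\<Phi>L n)) \<and>
     (\<forall>n. \<forall>k<n. inner_R \<mu> (\<lambda>z. mat (z ^ k)) (mp_eval (\<Phi>R n)) = 0) \<and>
     (\<forall>n. \<forall>k<n. inner_L \<mu> (\<lambda>z. mat (z ^ k)) (mp_eval (\<Phi>L n)) = 0) \<and>
     \<kappa>R 0 = mat 1 \<and> \<kappa>L 0 = mat 1 \<and>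
     (\<forall>n. posdef (matrix_inv (\<kappa>R n) ** \<kappa>R (Suc n))) \<and>
     (\<forall>n. posdef (\<kappa>L (Suc n) ** matrix_inv (\<kappa>L n))) \<and>
     (\<forall>n. inner_R \<mu> (\<lambda>z. mp_eval (\<Phi>R n) z ** \<kappa>R n) (\<lambda>z. mp_eval (\<Phi>R n) z ** \<kappa>R n) = mat 1 \<and>
          inner_L \<mu> (\<lambda>z. \<kappa>L n ** mp_eval (\<Phi>L n) z) (\<lambda>z. \<kappa>L n ** mp_eval (\<Phi>L n) z) = mat 1) \<and>
     (\<forall>n z. z \<noteq> 0 \<longrightarrow> mat z ** (\<kappa>L n ** mp_eval (\<Phi>L n) z) -
        \<kappa>L n ** matrix_inv (\<kappa>L (Suc n)) ** (\<kappa>L (Suc n) ** mp_eval (\<Phi>L (Suc n)) z) =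
        adj (a n) ** (mat (z ^ n) ** adj (mp_eval (\<Phi>R n) (1 / cnj z) ** \<kappa>R n)))"
    using verb unfolding verblunsky_def Let_def by (elim exE) (rule that)
  have
    monic: "\<And>n. mp_monic n (\<Phi>R n)" "\<And>n. mp_monic n (\<Phi>L n)"
    and orthR: "\<And>n k. k < n \<Longrightarrow> inner_R \<mu> (\<lambda>z. mat (z ^ k)) (mp_eval (\<Phi>R n)) = 0"
    and orthL: "\<And>n k. k < n \<Longrightarrow> inner_L \<mu> (\<lambda>z. mat (z ^ k)) (mp_eval (\<Phi>L n)) = 0"
    and \<kappa>0: "\<kappa>R 0 = mat 1" "\<kappa>L 0 = mat 1"
    and posR: "\<And>n. posdef (matrix_inv (\<kappa>R n) ** \<kappa>R (Suc n))"
    and posL: "\<And>n. posdef (\<kappa>L (Suc n) ** matrix_inv (\<kappa>L n))"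
    and normR: "\<And>n. inner_R \<mu> (\<lambda>z. mp_eval (\<Phi>R n) z ** \<kappa>R n) (\<lambda>z. mp_eval (\<Phi>R n) z ** \<kappa>R n) = mat 1"
    and normL: "\<And>n. inner_L \<mu> (\<lambda>z. \<kappa>L n ** mp_eval (\<Phi>L n) z) (\<lambda>z. \<kappa>L n ** mp_eval (\<Phi>L n) z) = mat 1"
    and rec: "\<And>n z. z \<noteq> 0 \<Longrightarrow> mat z ** (\<kappa>L n ** mp_eval (\<Phi>L n) z) -
        \<kappa>L n ** matrix_inv (\<kappa>L (Suc n)) ** (\<kappa>L (Suc n) ** mp_eval (\<Phi>L (Suc n)) z) =
        adj (a n) ** (mat (z ^ n) ** adj (mp_eval (\<Phi>R n) (1 / cnj z) ** \<kappa>R n))"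
    using data by auto
  have cont: "circle_cont (mp_eval r)" for r :: "(complex^'l^'l) poly"
    by (rule laurent_cont[OF laurent_mp_eval_degree[OF order_refl]])

  have LR: "adj (mp_eval (\<Phi>L n) (cnj z)) = mp_eval (\<Phi>R n) z" for n z
  proof -
    have "map_poly adj (\<Phi>L n) = \<Phi>R n"
    proof (rule monic_orthogonal_unique[OF nt _ monic(1) _ orthR])
      have "coeff (map_poly adj (\<Phi>L n)) n = mat 1"
        using monic(2)[of n] by (simp add: coeff_map_poly mp_monic_def)
      moreover have "(mat 1 :: complex^'l^'l) \<noteq> 0" by (simp add: vec_eq_iff mat_def)
      moreover have "degree (map_poly adj (\<Phi>L n)) \<le> n"
        using degree_map_poly_le[of adj "\<Phi>L n"] monic(2)[of n] by (simp add: mp_monic_def)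
      ultimately show "mp_monic n (map_poly adj (\<Phi>L n))"
        by (simp add: mp_monic_def le_antisym le_degree)
      fix k assume "k < n"
      then have "R (\<lambda>z. adj (mp_eval (\<Phi>L n) z)) (\<lambda>z. adj (mat (z ^ k))) = 0"
        using orthL[of k n] by (simp add: inner_L_eq_inner_R)
      then have "R (\<lambda>z. adj (mat (z ^ k))) (\<lambda>z. adj (mp_eval (\<Phi>L n) z)) = 0"
        by (metis R_adj adj_zero)
      then have "R (\<lambda>z. adj (mat (cnj z ^ k))) (\<lambda>z. adj (mp_eval (\<Phi>L n) (cnj z))) = 0"
        by (subst R_flip[of "\<lambda>z. adj (mat (z ^ k))"]) (auto intro!: cont continuous_intros)
      then show "R (\<lambda>z. mat (z ^ k)) (mp_eval (map_poly adj (\<Phi>L n))) = 0"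
        by (simp add: mp_eval_adj[abs_def])
    qed auto
    then show ?thesis by (metis mp_eval_adj)
  qed

  define N where "N n = R (mp_eval (\<Phi>R n)) (mp_eval (\<Phi>R n))" for n
  have NR: "adj (\<kappa>R n) ** N n ** \<kappa>R n = mat 1" for n
    using normR[of n] by (simp add: R_mult_left R_mult_right cont N_def circle_cont_mult circle_cont_const matrix_mul_assoc)
  have NL: "\<kappa>L n ** N n ** adj (\<kappa>L n) = mat 1" for n
  proof -
    have "mat 1 = R (\<lambda>z. adj (mp_eval (\<Phi>L n) z) ** adj (\<kappa>L n)) (\<lambda>z. adj (mp_eval (\<Phi>L n) z) ** adj (\<kappa>L n))"
      using normL[of n] by (simp add: inner_L_eq_inner_R adj_mult)
    also have "\<dots> = R (\<lambda>z. adj (mp_eval (\<Phi>L n) (cnj z)) ** adj (\<kappa>L n))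
        (\<lambda>z. adj (mp_eval (\<Phi>L n) (cnj z)) ** adj (\<kappa>L n))"
      by (rule R_flip[symmetric]) (intro circle_cont_mult circle_cont_const circle_cont_adj cont)+
    also have "\<dots> = \<kappa>L n ** N n ** adj (\<kappa>L n)"
      by (simp add: LR R_mult_left R_mult_right cont N_def circle_cont_mult circle_cont_const matrix_mul_assoc)
    finally show ?thesis by simp
  qed
  \<comment> \<open>Inductively, both quotients of consecutive leading coefficients are positive definite matrices \<open>X\<close>
        with \<open>X M X = 1\<close> for the same \<open>M\<close>, so they agree.\<close>
  have LRk: "\<kappa>L n = adj (\<kappa>R n)" for n
  proof (induction n)
    case 0
    show ?case by (simp add: \<kappa>0)
  next
    case (Suc n)
    define K where "K = \<kappa>R n"
    define K' where "K' = adj K ** N n"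
    have K: "K' ** K = mat 1" "K ** K' = mat 1"
      using NR[of n] by (simp_all add: K_def K'_def matrix_left_right_inverse)
    have aK: "adj K ** adj K' = mat 1" "adj K' ** adj K = mat 1"
      using K by (metis adj_mult adj_mat complex_cnj_one)+
    define P where "P = K' ** \<kappa>R (Suc n)"
    define Q where "Q = \<kappa>L (Suc n) ** adj K'"
    have pos: "posdef P" "posdef Q"
      using posR[of n] posL[of n] matrix_inv_eq[OF K(2)] matrix_inv_eq[OF aK(1)] Suc
      by (simp_all add: P_def Q_def K_def)
    have RK: "\<kappa>R (Suc n) = K ** P" by (simp add: P_def matrix_mul_assoc K)
    have LK: "\<kappa>L (Suc n) = Q ** adj K"
      by (simp add: Q_def matrix_mul_assoc[symmetric] aK)
    have "P = Q"
    proof (rule posdef_eq_if_same_congruence[OF pos])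
      show "P ** (adj K ** N (Suc n) ** K) ** P = mat 1"
        using NR[of "Suc n"] posdef_hermitian[OF pos(1)] by (simp add: RK adj_mult matrix_mul_assoc)
      show "Q ** (adj K ** N (Suc n) ** K) ** Q = mat 1"
        using NL[of "Suc n"] posdef_hermitian[OF pos(2)] by (simp add: LK adj_mult matrix_mul_assoc)
    qed
    then show ?case using RK LK posdef_hermitian[OF pos(1)] by (simp add: adj_mult)
  qed

  define \<phi> where "\<phi> n z = mp_eval (\<Phi>R n) z ** \<kappa>R n" for n z
  define \<rho> where "\<rho> n = \<kappa>L n ** matrix_inv (\<kappa>L (Suc n))" for n
  have \<rho>_pos: "posdef (\<rho> n)" for n
  proof -
    have inv: "\<kappa>L n ** matrix_inv (\<kappa>L n) = mat 1" "matrix_inv (\<kappa>L n) ** \<kappa>L n = mat 1" for n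
    proof -
      have "\<kappa>L n ** (N n ** adj (\<kappa>L n)) = mat 1" using NL[of n] by (simp add: matrix_mul_assoc)
      then show "\<kappa>L n ** matrix_inv (\<kappa>L n) = mat 1" using matrix_inv_eq by metis
      then show "matrix_inv (\<kappa>L n) ** \<kappa>L n = mat 1" by (simp add: matrix_left_right_inverse)
    qed
    obtain B where B: "B ** (\<kappa>L (Suc n) ** matrix_inv (\<kappa>L n)) = mat 1" "posdef B"
      using posdef_inverse[OF posL[of n]] by metis
    have "(\<kappa>L (Suc n) ** matrix_inv (\<kappa>L n)) ** \<rho> n =
        \<kappa>L (Suc n) ** (matrix_inv (\<kappa>L n) ** \<kappa>L n) ** matrix_inv (\<kappa>L (Suc n))"
      by (simp add: \<rho>_def matrix_mul_assoc)
    then have "(\<kappa>L (Suc n) ** matrix_inv (\<kappa>L n)) ** \<rho> n = mat 1" by (simp add: inv)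
    then have "\<rho> n = B" using B(1) by (metis matrix_mul_assoc matrix_mul_lid matrix_mul_rid)
    then show ?thesis using B(2) by simp
  qed
  have flip: "\<kappa>L n ** mp_eval (\<Phi>L n) z = adj (\<phi> n (cnj z))" for n z
    by (simp add: \<phi>_def adj_mult LRk LR[symmetric])
  have "symmetric_szego_recursion \<mu> \<phi> \<rho> a"
  proof
    fix n
    show "laurent 0 (int n) (\<phi> n)"
      using laurent_mult_right[OF laurent_mp_eval_degree[of "\<Phi>R n" n]] monic(1)[of n]
      by (simp add: mp_monic_def \<phi>_def[abs_def])
    show "R (\<phi> n) (\<phi> n) = mat 1" using normR by (simp add: \<phi>_def[abs_def])
    show "posdef (\<rho> n)" by (rule \<rho>_pos)
    fix j :: int assume "0 \<le> j" "j < int n"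
    then obtain k where k: "j = int k" "k < n" using zero_le_imp_eq_int by force
    have "R (\<lambda>z. mat (z ^ k)) (\<lambda>z. mp_eval (\<Phi>R n) z ** \<kappa>R n) = R (\<lambda>z. mat (z ^ k)) (mp_eval (\<Phi>R n)) ** \<kappa>R n"
      by (rule R_mult_right) (auto intro!: cont continuous_intros)
    then show "R (\<lambda>z. mat (z powi j)) (\<phi> n) = 0"
      using k orthR by (simp add: \<phi>_def[abs_def])
  next
    fix z :: complex
    show "\<phi> 0 z = mat 1" using monic(1)[of 0] by (simp add: \<phi>_def \<kappa>0 mp_eval_def mp_monic_def)
  next
    fix z :: complex and n
    assume z: "z \<in> sphere 0 1"
    then have zz: "1 / z = cnj z"
      by (metis complex_norm_square inverse_eq_divide inverse_unique of_real_1 power_one dist_0_norm mem_sphere)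
    have "cnj z \<noteq> 0" using z by auto
    from rec[OF this, of n]
    have "mat (cnj z) ** adj (\<phi> n z) - \<rho> n ** adj (\<phi> (Suc n) z) =
        adj (a n) ** (mat (cnj z ^ n) ** adj (\<phi> n (cnj z)))"
      unfolding flip \<rho>_def[symmetric] \<phi>_def[symmetric] by (simp add: zz)
    from arg_cong[OF this, of adj]
    have "mat z ** \<phi> n z - \<phi> (Suc n) z ** \<rho> n = mat (z ^ n) ** \<phi> n (cnj z) ** a n"
      by (simp add: adj_simps posdef_hermitian[OF \<rho>_pos] mat_commute)
    then show "mat z ** \<phi> n z = \<phi> (Suc n) z ** \<rho> n + mat (z ^ n) ** \<phi> n (cnj z) ** a n"
      by (simp add: algebra_simps)
  qed
  then show ?thesis by (rule that)
qed

end

section \<open>Consequences of the Szego recursion\<close>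

lemma circle_cnj: "z \<in> sphere 0 1 \<Longrightarrow> z * cnj z = 1"
  by (metis complex_norm_square dist_0_norm mem_sphere of_real_1 power_one)

lemma circle_nonzero: "z \<in> sphere 0 1 \<Longrightarrow> z \<noteq> 0"
  by auto

lemma circle_cnj_cancel: "z \<in> sphere 0 1 \<Longrightarrow> z * (cnj z * c) = c"
  using circle_cnj by (metis mult.assoc mult_1)

lemma circle_power_cancel: "z \<in> sphere 0 1 \<Longrightarrow> z * z ^ n * cnj z ^ n = z"
  using circle_cnj by (metis mult.assoc power_mult_distrib power_one mult.right_neutral)

lemma circle_powi_cancel: "z \<in> sphere 0 1 \<Longrightarrow> z powi m * z powi (- m) = (1::complex)"
  using circle_nonzero[of z] power_int_add[of z m "- m"] by (simp del: mem_sphere dist_0_norm)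

text \<open>Multiplication by \<open>x = z + 1/z = 2 cos \<theta>\<close>, the variable of the Szego image.\<close>

definition xmul :: "(complex \<Rightarrow> complex^'l^'l) \<Rightarrow> complex \<Rightarrow> complex^'l^'l" where
  "xmul f z = mat (of_real (2 * Re z)) ** f z"

lemma xmul_eq: "xmul f z = mat z ** f z + mat (cnj z) ** f z"
proof -
  have x: "of_real (2 * Re z) = z + cnj z" by (simp add: complex_add_cnj)
  show ?thesis unfolding xmul_def x by (simp add: vec_eq_iff distrib_right)
qed

lemma xmul_cont: "circle_cont f \<Longrightarrow> circle_cont (xmul f)"
  unfolding xmul_def[abs_def] by (intro circle_cont_mult circle_cont_mat continuous_intros)

lemma xmul_laurent: "laurent (- j) j f \<Longrightarrow> laurent (- (j + 1)) (j + 1) (xmul f)"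
proof -
  assume f: "laurent (- j) j f"
  have "laurent (- (j + 1)) (j + 1) (\<lambda>z. mat (z powi 1) ** f z + mat (z powi (- 1)) ** f z)"
    by (intro laurent_add laurent_mono[OF laurent_shift[OF f, of 1]] laurent_mono[OF laurent_shift[OF f, of "- 1"]]) auto
  then show ?thesis
    by (rule laurent_cong) (use circle_cnj_powi[of _ 1] in \<open>simp add: xmul_eq\<close>)
qed

context symmetric_szego_recursion
begin

text \<open>The reversed polynomial \<open>\<phi>\<^sup>L\<^sup>,\<^sup>*\<close>: on the circle it is \<open>z\<^sup>n \<phi>(1/z)\<close>, that is, \<open>\<phi>\<close> with its coefficients in
reversed order.\<close>

definition \<phi>s :: "nat \<Rightarrow> complex \<Rightarrow> complex^'l^'l" where
  "\<phi>s n z = mat (z ^ n) ** \<phi> n (cnj z)"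

lemma \<phi>_cont: "circle_cont (\<phi> n)"
  by (rule laurent_cont[OF \<phi>_laurent])

lemma \<phi>s_laurent: "laurent 0 (int n) (\<phi>s n)"
proof -
  have "laurent (- int n + int n) (- 0 + int n) (\<lambda>z. mat (z powi int n) ** \<phi> n (cnj z))"
    by (rule laurent_shift[OF laurent_flip[OF \<phi>_laurent]])
  then show ?thesis by (simp add: \<phi>s_def[abs_def])
qed

lemma \<phi>s_cont: "circle_cont (\<phi>s n)"
  by (rule laurent_cont[OF \<phi>s_laurent])

lemmas conts = \<phi>_cont \<phi>s_cont circle_cont_add circle_cont_mult circle_cont_const
  circle_cont_id circle_cont_monomial circle_cont_flip

lemma R_\<phi>_perp:
  assumes "laurent i j f" "m \<le> i" "j < m + int n"
  shows "R f (\<lambda>z. mat (z powi m) ** \<phi> n z) = 0"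
proof -
  have "R f (\<lambda>z. mat (z powi m) ** \<phi> n z) =
    R (\<lambda>z. mat (z powi m) ** (mat (z powi (- m)) ** f z)) (\<lambda>z. mat (z powi m) ** \<phi> n z)"
    by (rule R_cong) (simp_all add: circle_powi_cancel del: mem_sphere dist_0_norm)
  also have "\<dots> = R (\<lambda>z. mat (z powi (- m)) ** f z) (\<phi> n)"
    by (rule R_unimodular) (simp add: norm_power_int)
  also have "\<dots> = 0"
    by (rule R_laurent_zero[OF laurent_shift[OF assms(1)] \<phi>_cont \<phi>_orth]) (use assms in auto)
  finally show ?thesis .
qed

lemma R_\<phi>_flip_perp:
  assumes f: "laurent i j f" "- m - int n < i" "j \<le> - m"
  shows "R f (\<lambda>z. mat (z powi (- m)) ** \<phi> n (cnj z)) = 0"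
proof -
  have "R f (\<lambda>z. mat (z powi (- m)) ** \<phi> n (cnj z)) =
      R (\<lambda>z. f (cnj z)) (\<lambda>z. mat (cnj z powi (- m)) ** \<phi> n (cnj (cnj z)))"
    by (rule R_flip[symmetric]) (intro conts laurent_cont[OF f(1)])+
  also have "\<dots> = R (\<lambda>z. f (cnj z)) (\<lambda>z. mat (z powi m) ** \<phi> n z)"
    by (rule R_cong) (use circle_cnj_powi in auto)
  also have "\<dots> = 0"
    by (rule R_\<phi>_perp[OF laurent_flip[OF f(1)]]) (use f in auto)
  finally show ?thesis .
qed

lemma R_\<phi>_zero: "laurent 0 j f \<Longrightarrow> j < int n \<Longrightarrow> R f (\<phi> n) = 0"
  using R_\<phi>_perp[of 0 j f 0 n] by simp

lemma R_\<phi>_zero': "laurent 0 j f \<Longrightarrow> j < int n \<Longrightarrow> R (\<phi> n) f = 0"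
  by (metis R_\<phi>_zero R_adj adj_zero)

lemma R_flip_unimodular:
  assumes "circle_cont f" "circle_cont g"
  shows "R (\<lambda>z. mat (z ^ n) ** f (cnj z)) (\<lambda>z. mat (z ^ n) ** g (cnj z)) = R f g"
  by (subst R_unimodular) (auto simp: norm_power R_flip[OF assms])

lemma \<phi>s_norm: "R (\<phi>s n) (\<phi>s n) = mat 1"
  by (simp add: \<phi>s_def[abs_def] R_flip_unimodular \<phi>_cont \<phi>_norm)

lemma recursion_\<phi>s: "z \<in> sphere 0 1 \<Longrightarrow> mat z ** \<phi> n z = \<phi> (Suc n) z ** \<rho> n + \<phi>s n z ** a n"
  using recursion by (simp add: \<phi>s_def)

lemma R_recursion:
  assumes "circle_cont f"
  shows "R f (\<lambda>z. mat z ** \<phi> n z) = R f (\<phi> (Suc n)) ** \<rho> n + R f (\<phi>s n) ** a n"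
proof -
  have "R f (\<lambda>z. mat z ** \<phi> n z) = R f (\<lambda>z. \<phi> (Suc n) z ** \<rho> n + \<phi>s n z ** a n)"
    by (rule R_cong) (simp_all add: recursion_\<phi>s)
  then show ?thesis
    using assms by (simp add: R_add_right R_mult_right conts)
qed

lemma R_\<phi>s_z\<phi>: "R (\<phi>s n) (\<lambda>z. mat z ** \<phi> n z) = a n"
  using R_\<phi>_zero[OF \<phi>s_laurent, of n "Suc n"] by (simp add: R_recursion \<phi>s_cont \<phi>s_norm)

text \<open>The map \<open>f(z) \<mapsto> z\<^sup>n\<^sup>+\<^sup>1 f(cnj z)\<close> preserves the form and exchanges \<open>z \<phi>\<close> with \<open>\<phi>s\<close>, so that
\<open>a = R \<phi>s (z \<phi>) = R (z \<phi>) \<phi>s = a\<^sup>\<dagger>\<close>.\<close>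

lemma a_hermitian: "adj (a n) = a n"
proof -
  have "adj (a n) = R (\<lambda>z. mat z ** \<phi> n z) (\<phi>s n)"
    using R_\<phi>s_z\<phi>[of n] by (metis R_adj)
  also have "\<dots> = R (\<lambda>z. mat (z ^ Suc n) ** (mat (cnj z) ** \<phi> n (cnj z)))
      (\<lambda>z. mat (z ^ Suc n) ** \<phi>s n (cnj z))"
    by (rule R_flip_unimodular[symmetric]) (intro conts)+
  also have "\<dots> = R (\<phi>s n) (\<lambda>z. mat z ** \<phi> n z)"
  proof (rule R_cong)
    fix z :: complex assume z: "z \<in> sphere 0 1"
    show "mat (z ^ Suc n) ** (mat (cnj z) ** \<phi> n (cnj z)) = \<phi>s n z"
      by (simp add: \<phi>s_def circle_cnj_cancel[OF z] mult_ac)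
    show "mat (z ^ Suc n) ** \<phi>s n (cnj z) = mat z ** \<phi> n z"
      by (simp add: \<phi>s_def circle_power_cancel[OF z])
  qed
  also have "\<dots> = a n" by (rule R_\<phi>s_z\<phi>)
  finally show ?thesis .
qed

text \<open>Pythagoras in the recursion: \<open>z \<phi>\<^bsub>n\<^esub>\<close>, \<open>\<phi>\<^bsub>n+1\<^esub>\<close> and \<open>\<phi>s\<^bsub>n\<^esub>\<close> are normalized, and the last two are orthogonal.\<close>

lemma \<rho>_square: "\<rho> n ** \<rho> n = mat 1 - a n ** a n"
proof -
  let ?f = "\<lambda>z. \<phi> (Suc n) z ** \<rho> n + \<phi>s n z ** a n"
  have "mat 1 = R (\<lambda>z. mat z ** \<phi> n z) (\<lambda>z. mat z ** \<phi> n z)"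
    by (subst R_unimodular) (simp_all add: \<phi>_norm)
  also have "\<dots> = R ?f ?f"
    by (rule R_cong) (simp_all add: recursion_\<phi>s)
  also have "\<dots> = \<rho> n ** \<rho> n + a n ** a n"
    using R_\<phi>_zero[OF \<phi>s_laurent, of n "Suc n"] R_\<phi>_zero'[OF \<phi>s_laurent, of n "Suc n"]
    by (simp add: R_add_right R_add_left R_mult_right R_mult_left conts \<phi>_norm \<phi>s_norm a_hermitian
        posdef_hermitian[OF \<rho>_pos])
  finally show ?thesis by (simp add: algebra_simps)
qed

lemma one_minus_square_psd: "psd (mat 1 - a n ** a n)"
  using psd_square[OF posdef_hermitian[OF \<rho>_pos]] \<rho>_square by metis

lemma \<rho>_eq: "mat_sqrt (mat 1 - a n ** a n) = \<rho> n"
  by (rule mat_sqrt_eqI) (simp_all add: posdef_imp_psd \<rho>_pos \<rho>_square)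

lemma a_\<rho>_commute: "a n ** \<rho> n = \<rho> n ** a n"
  using mat_sqrt_commute[OF one_minus_square_psd, of "a n" n]
  by (simp add: \<rho>_eq matrix_ring_simps matrix_mul_assoc)

text \<open>Conjugating \<open>z\<close> in the recursion gives \<open>\<phi>s\<^bsub>n\<^esub> = \<phi>s\<^bsub>n+1\<^esub> \<rho> + z \<phi>\<^bsub>n\<^esub> a\<close>. Eliminating \<open>z \<phi>\<^bsub>n\<^esub>\<close> by the recursion
itself and using \<open>\<rho>\<^sup>2 = 1 - a\<^sup>2\<close> leaves a form free of the factor \<open>z\<close>. Its two summands lie in
the span of \<open>1, ..., z\<^sup>n\<close> and in the direction of \<open>\<phi>\<^bsub>n+1\<^esub>\<close>, which makes inner products
with \<open>\<phi>s\<^bsub>n+1\<^esub>\<close> immediate.\<close>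

lemma recursion_\<phi>s_Suc:
  assumes z: "z \<in> sphere 0 1"
  shows "\<phi>s (Suc n) z = \<phi>s n z ** \<rho> n - \<phi> (Suc n) z ** a n"
proof -
  have "mat (z ^ Suc n) ** (mat (cnj z) ** \<phi> n (cnj z)) =
      mat (z ^ Suc n) ** (\<phi> (Suc n) (cnj z) ** \<rho> n + mat (cnj z ^ n) ** \<phi> n (cnj (cnj z)) ** a n)"
    using recursion[of "cnj z" n] z by simp
  moreover have "mat (z ^ Suc n) ** (mat (cnj z) ** \<phi> n (cnj z)) = \<phi>s n z"
    by (simp add: \<phi>s_def circle_cnj_cancel[OF z] mult_ac)
  ultimately have "\<phi>s n z = \<phi>s (Suc n) z ** \<rho> n + (mat z ** \<phi> n z) ** a n"
    by (simp add: \<phi>s_def matrix_add_ldistrib matrix_mul_assoc circle_power_cancel[OF z])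
  then have "\<phi>s (Suc n) z ** \<rho> n = \<phi>s n z ** (\<rho> n ** \<rho> n) - \<phi> (Suc n) z ** (\<rho> n ** a n)"
    unfolding recursion_\<phi>s[OF z] \<rho>_square
    by (simp add: matrix_ring_simps matrix_mul_assoc algebra_simps)
  then have eq: "\<phi>s (Suc n) z ** \<rho> n = (\<phi>s n z ** \<rho> n - \<phi> (Suc n) z ** a n) ** \<rho> n"
    by (simp add: a_\<rho>_commute[symmetric] matrix_ring_simps matrix_mul_assoc)
  obtain B where "\<rho> n ** B = mat 1" using posdef_inverse[OF \<rho>_pos] by blast
  then show ?thesis
    using arg_cong[OF eq, of "\<lambda>M. M ** B"] by (simp add: matrix_mul_assoc[symmetric])
qed

lemma R_recursion_\<phi>s:
  assumes "circle_cont f"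
  shows "R f (\<phi>s (Suc n)) = R f (\<phi>s n) ** \<rho> n - R f (\<phi> (Suc n)) ** a n"
proof -
  have "R f (\<phi>s (Suc n)) = R f (\<lambda>z. \<phi>s n z ** \<rho> n - \<phi> (Suc n) z ** a n)"
    by (rule R_cong) (simp_all add: recursion_\<phi>s_Suc)
  then show ?thesis
    using assms by (simp add: R_diff_right R_mult_right conts)
qed

lemma R_recursion_z\<phi>s:
  assumes "circle_cont f"
  shows "R f (\<lambda>z. mat z ** \<phi>s (Suc n) z) =
    R f (\<lambda>z. mat z ** \<phi>s n z) ** \<rho> n - R f (\<lambda>z. mat z ** \<phi> (Suc n) z) ** a n"
proof -
  have "R f (\<lambda>z. mat z ** \<phi>s (Suc n) z) =
      R f (\<lambda>z. (mat z ** \<phi>s n z) ** \<rho> n - (mat z ** \<phi> (Suc n) z) ** a n)"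
    by (rule R_cong) (simp_all add: recursion_\<phi>s_Suc matrix_diff_ldistrib matrix_mul_assoc)
  then show ?thesis
    using assms by (simp add: R_diff_right R_mult_right conts)
qed

text \<open>The Verblunsky coefficients shifted by one index, with \<open>\<alpha>\<^bsub>-1\<^esub> = -1\<close> in front. This convention makes
\<open>R \<phi>\<^bsub>n\<^esub> \<phi>s\<^bsub>n\<^esub> = - b\<^bsub>n\<^esub>\<close> valid for \<open>n = 0\<close> too, where \<open>\<phi>\<^bsub>0\<^esub> = \<phi>s\<^bsub>0\<^esub> = 1\<close>.\<close>

definition b :: "nat \<Rightarrow> complex^'l^'l" where
  "b n = (case n of 0 \<Rightarrow> - mat 1 | Suc m \<Rightarrow> a m)"

lemma b_hermitian: "adj (b n) = b n"
  by (simp add: b_def a_hermitian adj_minus split: nat.split)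

lemma R_\<phi>_\<phi>s: "R (\<phi> n) (\<phi>s n) = - b n"
proof (cases n)
  case 0
  have "R (\<phi> n) (\<phi>s n) = R (\<lambda>_. mat 1) (\<lambda>_. mat 1)"
    unfolding 0 by (rule R_cong) (simp_all add: \<phi>_0 \<phi>s_def)
  then show ?thesis by (simp add: 0 b_def R_one)
next
  case (Suc m)
  then show ?thesis
    using R_\<phi>_zero'[OF \<phi>s_laurent, of m "Suc m"]
    by (simp add: b_def R_recursion_\<phi>s \<phi>_cont \<phi>_norm)
qed

lemma R_\<phi>s_\<phi>: "R (\<phi>s n) (\<phi> n) = - b n"
  using R_\<phi>_\<phi>s[of n] by (metis R_adj adj_minus b_hermitian)

lemma R_\<phi>_z\<phi>: "R (\<phi> n) (\<lambda>z. mat z ** \<phi> n z) = - (b n ** a n)"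
  using R_\<phi>_zero[OF \<phi>_laurent, of n "Suc n"]
  by (simp add: R_recursion \<phi>_cont R_\<phi>_\<phi>s matrix_minus_left)

lemma R_\<phi>s_z\<phi>s: "R (\<phi>s n) (\<lambda>z. mat z ** \<phi>s n z) = - (a n ** b n)"
proof -
  have "R (\<phi>s n) (\<lambda>z. mat z ** \<phi>s n z) =
      R (\<lambda>z. mat (z ^ n) ** \<phi> n (cnj z)) (\<lambda>z. mat (z ^ n) ** (mat (cnj (cnj z)) ** \<phi> n (cnj z)))"
    by (rule R_cong) (simp_all add: \<phi>s_def mult.commute)
  also have "\<dots> = R (\<phi> n) (\<lambda>z. mat (cnj z) ** \<phi> n z)"
    by (rule R_flip_unimodular) (auto intro!: conts circle_cont_mat continuous_intros)
  also have "\<dots> = R (\<lambda>z. mat z ** \<phi> n z) (\<phi> n)" by (simp add: R_shift)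
  also have "\<dots> = adj (R (\<phi> n) (\<lambda>z. mat z ** \<phi> n z))" by (simp add: R_adj)
  also have "\<dots> = - (a n ** b n)" by (simp add: R_\<phi>_z\<phi> adj_simps a_hermitian b_hermitian)
  finally show ?thesis .
qed

text \<open>Two steps of \<open>recursion_\<phi>s_Suc\<close> reduce \<open>z \<phi>s\<^bsub>n+2\<^esub>\<close> to \<open>z \<phi>s\<^bsub>n\<^esub>\<close>, which has degree at most \<open>n + 1\<close>
and is therefore orthogonal to \<open>\<phi>\<^bsub>n+2\<^esub>\<close>. This is how the coefficient with index two lower enters
the diagonal Jacobi parameters.\<close>

lemma R_\<phi>_z\<phi>s:
  "R (\<phi> (Suc (Suc n))) (\<lambda>z. mat z ** \<phi>s (Suc (Suc n)) z) =
    a (Suc n) ** a (Suc (Suc n)) ** a (Suc n) - \<rho> (Suc n) ** a n ** \<rho> (Suc n)"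
proof -
  have "R (\<phi> (Suc (Suc n))) (\<lambda>z. mat z ** \<phi>s n z) = 0"
  proof (rule R_\<phi>_zero')
    have "laurent (0 + 1) (int n + 1) (\<lambda>z. mat (z powi 1) ** \<phi>s n z)"
      by (rule laurent_shift[OF \<phi>s_laurent])
    then show "laurent 0 (int n + 1) (\<lambda>z. mat z ** \<phi>s n z)"
      by (auto intro: laurent_mono)
  qed simp
  moreover have "R (\<phi> (Suc (Suc n))) (\<lambda>z. mat z ** \<phi> (Suc n) z) = \<rho> (Suc n)"
    using R_\<phi>_zero'[OF \<phi>s_laurent, of "Suc n" "Suc (Suc n)"] by (simp add: R_recursion \<phi>_cont \<phi>_norm)
  ultimately have "R (\<phi> (Suc (Suc n))) (\<lambda>z. mat z ** \<phi>s (Suc n) z) = - (\<rho> (Suc n) ** a n)"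
    by (simp add: R_recursion_z\<phi>s \<phi>_cont)
  moreover have "R (\<phi> (Suc (Suc n))) (\<lambda>z. mat z ** \<phi> (Suc (Suc n)) z) = - (a (Suc n) ** a (Suc (Suc n)))"
    by (simp add: R_\<phi>_z\<phi> b_def)
  ultimately show ?thesis
    by (subst R_recursion_z\<phi>s[OF \<phi>_cont]) (simp add: matrix_minus_left)
qed

section \<open>Symmetrized orthogonal polynomials\<close>

text \<open>On the circle this is \<open>z\<^sup>-\<^sup>k \<phi>\<^bsub>2k\<^esub>(z) + z\<^sup>k \<phi>\<^bsub>2k\<^esub>(1/z)\<close>, the symmetrization of \<open>u\<close> below. It is invariant
under \<open>z \<mapsto> 1/z\<close>, hence a polynomial in \<open>x\<close>.\<close>

definition e :: "nat \<Rightarrow> complex \<Rightarrow> complex^'l^'l" where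
  "e k z = mat (z powi (- int k)) ** (\<phi> (2 * k) z + \<phi>s (2 * k) z)"

definition u :: "nat \<Rightarrow> complex \<Rightarrow> complex^'l^'l" where
  "u k z = mat (z powi (- int k)) ** \<phi> (2 * k) z"

lemma u_laurent: "laurent (- int k) (int k) (u k)"
  using laurent_shift[OF \<phi>_laurent[of "2 * k"], of "- int k"] by (simp add: u_def[abs_def])

lemma e_eq: "z \<in> sphere 0 1 \<Longrightarrow> e k z = u k z + u k (cnj z)"
proof -
  assume z: "z \<in> sphere 0 1"
  have "z powi (- int k) * z ^ (2 * k) = z powi (- int k) * z powi (int (2 * k))"
    by (simp only: power_int_of_nat)
  also have "\<dots> = z powi (- int k + int (2 * k))"
    using circle_nonzero[OF z] by (intro power_int_add[symmetric]) simp
  also have "\<dots> = cnj z powi (- int k)" by (simp add: circle_cnj_powi[OF z])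
  finally show ?thesis by (simp add: e_def u_def \<phi>s_def matrix_add_ldistrib)
qed

lemma e_flip: "z \<in> sphere 0 1 \<Longrightarrow> e k (cnj z) = e k z"
  using e_eq[of z k] e_eq[of "cnj z" k] by simp

lemma e_laurent: "laurent (- int k) (int k) (e k)"
  by (rule laurent_cong[OF laurent_add[OF u_laurent laurent_flip[OF u_laurent, simplified]]])
    (simp add: e_eq)

lemma e_cont: "circle_cont (e k)"
  by (rule laurent_cont[OF e_laurent])

text \<open>\<open>z\<^sup>-\<^sup>k \<phi>\<^bsub>2k\<^esub>\<close> is orthogonal to the powers of \<open>z\<close> from \<open>-k\<close> to \<open>k - 1\<close>, and its mirror image to those from
\<open>-k + 1\<close> to \<open>k\<close>. Their sum is thus orthogonal to the symmetric range between \<open>-k + 1\<close> and \<open>k - 1\<close>.\<close>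

lemma R_e_perp:
  assumes f: "laurent (- j) j f" "j < int k"
  shows "R f (e k) = 0"
proof -
  have "R f (e k) = R f (\<lambda>z. u k z + u k (cnj z))"
    by (rule R_cong) (simp_all add: e_eq)
  also have "\<dots> = R f (u k) + R f (\<lambda>z. u k (cnj z))"
    by (intro R_add_right circle_cont_flip laurent_cont[OF f(1)] laurent_cont[OF u_laurent])
  also have "R f (u k) = 0"
    unfolding u_def[abs_def] by (rule R_\<phi>_perp[OF f(1)]) (use f in auto)
  also have "R f (\<lambda>z. u k (cnj z)) = R f (\<lambda>z. mat (z powi (- (- int k))) ** \<phi> (2 * k) (cnj z))"
    unfolding u_def by (rule R_cong) (use circle_cnj_powi in auto)
  also have "\<dots> = 0"
    by (rule R_\<phi>_flip_perp[OF f(1)]) (use f in auto)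
  finally show ?thesis by simp
qed

lemma R_e_e: "R (e k) (e k) = 2 *\<^sub>R (mat 1 - b (2 * k))"
proof -
  have "R (e k) (e k) = R (\<lambda>z. \<phi> (2 * k) z + \<phi>s (2 * k) z) (\<lambda>z. \<phi> (2 * k) z + \<phi>s (2 * k) z)"
    unfolding e_def[abs_def] by (rule R_unimodular) (simp add: norm_power_int)
  then show ?thesis
    by (simp add: R_add_left R_add_right conts \<phi>_norm \<phi>s_norm R_\<phi>_\<phi>s R_\<phi>s_\<phi> scaleR_2 algebra_simps)
qed

lemma R_xmul: "R f (xmul g) = R (xmul f) g"
  by (simp add: xmul_def[abs_def] R_shift)

text \<open>The terms with \<open>z\<close> and \<open>1/z\<close> in \<open>x\<close> contribute equally by symmetry, so only multiplication by \<open>z\<close> has to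
be computed.\<close>

lemma R_e_x_e: "R (e k) (xmul (e m)) = 2 *\<^sub>R R (e k) (\<lambda>z. mat z ** e m z)"
proof -
  have c: "circle_cont (\<lambda>z. mat (cnj z) ** e m z)"
    by (intro conts circle_cont_mat e_cont continuous_intros)
  have "R (e k) (xmul (e m)) = R (e k) (\<lambda>z. mat z ** e m z) + R (e k) (\<lambda>z. mat (cnj z) ** e m z)"
    unfolding xmul_eq[abs_def] by (intro R_add_right conts e_cont c)
  also have "R (e k) (\<lambda>z. mat (cnj z) ** e m z) = R (\<lambda>z. e k (cnj z)) (\<lambda>z. mat (cnj (cnj z)) ** e m (cnj z))"
    by (rule R_flip[symmetric]) (intro e_cont c)+
  also have "\<dots> = R (e k) (\<lambda>z. mat z ** e m z)"
    by (rule R_cong) (simp_all add: e_flip)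
  finally show ?thesis by (simp add: scaleR_2)
qed

lemma R_e_z_e:
  "R (e k) (\<lambda>z. mat z ** e k z) = R (\<lambda>z. \<phi> (2 * k) z + \<phi>s (2 * k) z)
    (\<lambda>z. mat z ** \<phi> (2 * k) z + mat z ** \<phi>s (2 * k) z)"
proof -
  have "R (e k) (\<lambda>z. mat z ** e k z) = R (\<lambda>z. mat (z powi (- int k)) ** (\<phi> (2 * k) z + \<phi>s (2 * k) z))
    (\<lambda>z. mat (z powi (- int k)) ** (mat z ** \<phi> (2 * k) z + mat z ** \<phi>s (2 * k) z))"
    by (rule R_cong) (simp_all add: e_def matrix_add_ldistrib mult.commute)
  also have "\<dots> = R (\<lambda>z. \<phi> (2 * k) z + \<phi>s (2 * k) z)
    (\<lambda>z. mat z ** \<phi> (2 * k) z + mat z ** \<phi>s (2 * k) z)"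
    by (rule R_unimodular) (simp add: norm_power_int)
  finally show ?thesis .
qed

lemma R_e_x_e_diag_0: "R (e 0) (xmul (e 0)) = 8 *\<^sub>R a 0"
proof -
  have \<phi>s0: "\<phi>s 0 z = \<phi> 0 z" if "z \<in> sphere 0 1" for z using that by (simp add: \<phi>s_def \<phi>_0)
  have "R (e 0) (\<lambda>z. mat z ** e 0 z) = R (\<lambda>z. \<phi>s 0 z + \<phi>s 0 z) (\<lambda>z. mat z ** \<phi> 0 z + mat z ** \<phi> 0 z)"
    unfolding R_e_z_e by (rule R_cong) (simp_all add: \<phi>s0)
  also have "\<dots> = 4 *\<^sub>R a 0"
    by (simp only: R_add_left R_add_right conts R_\<phi>s_z\<phi>)
      (simp add: vec_eq_iff scaleR_conv_of_real)
  finally show ?thesis by (simp add: R_e_x_e)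
qed

text \<open>The four inner products of \<open>\<phi>\<close>, \<open>\<phi>s\<close> with \<open>z \<phi>\<close>, \<open>z \<phi>s\<close> at index \<open>2k + 2\<close> are \<open>- a' a\<close>, \<open>a' a a' - \<rho> a'' \<rho>\<close>, \<open>a\<close>
and \<open>- a a'\<close>, where \<open>a\<close>, \<open>a'\<close> and \<open>a''\<close> are the Verblunsky coefficients with indices \<open>2k + 2\<close>, \<open>2k + 1\<close> and \<open>2k\<close>;
the terms without \<open>\<rho>\<close> add up to \<open>(1 - a') a (1 - a')\<close>.\<close>

lemma R_e_x_e_diag_Suc:
  fixes k defines "n \<equiv> 2 * k"
  shows "R (e (Suc k)) (xmul (e (Suc k))) = 2 *\<^sub>R
    ((mat 1 - a (Suc n)) ** a (Suc (Suc n)) ** (mat 1 - a (Suc n)) - \<rho> (Suc n) ** a n ** \<rho> (Suc n))"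
proof -
  have "R (e (Suc k)) (\<lambda>z. mat z ** e (Suc k) z) =
      (mat 1 - a (Suc n)) ** a (Suc (Suc n)) ** (mat 1 - a (Suc n)) - \<rho> (Suc n) ** a n ** \<rho> (Suc n)"
    unfolding R_e_z_e
    by (simp add: n_def R_add_left R_add_right conts R_\<phi>s_z\<phi> R_\<phi>_z\<phi> R_\<phi>s_z\<phi>s R_\<phi>_z\<phi>s b_def
        matrix_ring_simps algebra_simps)
  then show ?thesis by (simp only: R_e_x_e)
qed

text \<open>After removing the common factor \<open>z\<^sup>-\<^sup>k\<close>, degree reasons leave only the pairing with
\<open>\<phi>s\<^bsub>2k+2\<^esub>\<close>, and two steps of its recursion reduce it to \<open>\<phi>s\<^bsub>2k\<^esub> \<rho>\<^bsub>2k\<^esub> \<rho>\<^bsub>2k+1\<^esub>\<close>, up to multiples of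
\<open>\<phi>\<^bsub>2k+1\<^esub>\<close> and \<open>\<phi>\<^bsub>2k+2\<^esub>\<close>, which are orthogonal to everything of degree at most \<open>2k\<close>.\<close>

lemma R_e_x_e_Suc:
  "R (e k) (xmul (e (Suc k))) =
    2 *\<^sub>R ((mat 1 - b (2 * k)) ** \<rho> (2 * k) ** \<rho> (Suc (2 * k)))"
proof -
  define n where "n = 2 * k"
  let ?f = "\<lambda>z. \<phi> n z + \<phi>s n z"
  have c: "circle_cont ?f" by (intro conts)
  have l: "laurent 0 (int n) ?f" by (intro laurent_add \<phi>_laurent \<phi>s_laurent)
  have "R (e k) (\<lambda>z. mat z ** e (Suc k) z) =
    R (\<lambda>z. mat (z powi (- int k)) ** ?f z) (\<lambda>z. mat (z powi (- int k)) ** (\<phi> (Suc (Suc n)) z + \<phi>s (Suc (Suc n)) z))"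
  proof (rule R_cong)
    fix z :: complex assume z: "z \<in> sphere 0 1"
    have "z powi 1 * z powi (- int (Suc k)) = z powi (1 + (- int (Suc k)))"
      using circle_nonzero[OF z] by (intro power_int_add[symmetric]) simp
    then have "z * z powi (- int (Suc k)) = z powi (- int k)" by simp
    then show "mat z ** e (Suc k) z = mat (z powi (- int k)) ** (\<phi> (Suc (Suc n)) z + \<phi>s (Suc (Suc n)) z)"
      by (simp add: e_def n_def)
  qed (simp add: e_def n_def)
  also have "\<dots> = R ?f (\<lambda>z. \<phi> (Suc (Suc n)) z + \<phi>s (Suc (Suc n)) z)"
    by (rule R_unimodular) (simp add: norm_power_int)
  also have "\<dots> = R ?f (\<phi>s n) ** \<rho> n ** \<rho> (Suc n)"
    using R_\<phi>_zero[OF l, of "Suc n"] R_\<phi>_zero[OF l, of "Suc (Suc n)"]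
    by (simp add: R_add_right conts c R_recursion_\<phi>s[OF c])
  also have "R ?f (\<phi>s n) = mat 1 - b n"
    by (simp add: R_add_left conts R_\<phi>_\<phi>s \<phi>s_norm)
  finally show ?thesis by (simp only: R_e_x_e n_def)
qed

lemma R_e_x_e_far: "Suc k < m \<Longrightarrow> R (e k) (xmul (e m)) = 0"
  unfolding R_xmul by (rule R_e_perp[OF xmul_laurent[OF e_laurent]]) simp

end

section \<open>Symmetric Laurent polynomials as polynomials in x\<close>

lemma mat_add_distrib: "mat (x + y) = (mat x + mat y :: complex^'l^'l)"
  and mat_diff_distrib: "mat (x - y) = (mat x - mat y :: complex^'l^'l)"
  by (simp_all add: vec_eq_iff mat_def)

text \<open>The Chebyshev recursion: \<open>s\<^bsub>k\<^esub> = z\<^sup>k + z\<^sup>-\<^sup>k\<close> satisfies \<open>s\<^bsub>k+2\<^esub> = x s\<^bsub>k+1\<^esub> - s\<^bsub>k\<^esub>\<close>.\<close>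

lemma power_sum_polynomial:
  "\<exists>P. degree P \<le> k \<and>
    (\<forall>z\<in>sphere 0 1. mp_eval P (of_real (2 * Re z)) = (mat (z ^ k + cnj z ^ k) :: complex^'l^'l))"
proof (induction k rule: less_induct)
  case (less k)
  consider "k = 0" | "k = 1" | j where "k = Suc (Suc j)"
    by (metis One_nat_def not0_implies_Suc)
  then show ?case
  proof cases
    case 1
    then show ?thesis by (intro exI[of _ "[:mat 2:]"]) simp
  next
    case 2
    then show ?thesis
      by (intro exI[of _ "pCons 0 [:mat 1:]"]) (simp add: mp_eval_shift complex_add_cnj degree_pCons_le del: One_nat_def)
  next
    case 3
    obtain P where P: "degree P \<le> Suc j"
      "\<And>z. z \<in> sphere 0 1 \<Longrightarrow> mp_eval P (of_real (2 * Re z)) = (mat (z ^ Suc j + cnj z ^ Suc j) :: complex^'l^'l)"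
      using less[of "Suc j"] 3 by auto
    obtain Q where Q: "degree Q \<le> j"
      "\<And>z. z \<in> sphere 0 1 \<Longrightarrow> mp_eval Q (of_real (2 * Re z)) = (mat (z ^ j + cnj z ^ j) :: complex^'l^'l)"
      using less[of j] 3 by auto
    have "degree (pCons 0 P) \<le> k" using P(1) 3 degree_pCons_le[of 0 P] by simp
    then have "degree (pCons 0 P - Q) \<le> k"
      using Q(1) 3 by (intro degree_diff_le) auto
    moreover have "mp_eval (pCons 0 P - Q) (of_real (2 * Re z)) = (mat (z ^ k + cnj z ^ k) :: complex^'l^'l)"
      if z: "z \<in> sphere 0 1" for z
    proof -
      have x: "of_real (2 * Re z) = z + cnj z" by (simp add: complex_add_cnj)
      have "mp_eval (pCons 0 P - Q) (of_real (2 * Re z)) =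
          (mat ((z + cnj z) * (z ^ Suc j + cnj z ^ Suc j) - (z ^ j + cnj z ^ j)) :: complex^'l^'l)"
        unfolding mp_eval_diff mp_eval_shift P(2)[OF z] Q(2)[OF z] unfolding x by (simp add: mat_diff_distrib)
      also have "(z + cnj z) * (z ^ Suc j + cnj z ^ Suc j) - (z ^ j + cnj z ^ j) =
          z ^ k + cnj z ^ k + (z * cnj z - 1) * (z ^ j + cnj z ^ j)"
        by (simp add: 3 algebra_simps)
      finally show ?thesis by (simp add: circle_cnj[OF z])
    qed
    ultimately show ?thesis by blast
  qed
qed

lemma symmetrized_laurent_polynomial:
  assumes "laurent (- int k) (int k) f"
  shows "\<exists>P. degree P \<le> k \<and> (\<forall>z\<in>sphere 0 1. mp_eval P (of_real (2 * Re z)) = f z + f (cnj z))"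
  using assms
proof (induction rule: laurent.induct)
  case (zero f)
  then show ?case by (intro exI[of _ 0]) (simp add: mp_eval_def)
next
  case (step h j f C)
  obtain P where P: "degree P \<le> k"
    "\<And>z. z \<in> sphere 0 1 \<Longrightarrow> mp_eval P (of_real (2 * Re z)) = h z + h (cnj z)"
    using step.IH by blast
  obtain Q where Q: "degree Q \<le> nat \<bar>j\<bar>"
    "\<And>z. z \<in> sphere 0 1 \<Longrightarrow>
      mp_eval Q (of_real (2 * Re z)) = (mat (z ^ nat \<bar>j\<bar> + cnj z ^ nat \<bar>j\<bar>) :: complex^'a^'a)"
    using power_sum_polynomial by blast
  define Q' where "Q' = map_poly (\<lambda>M. M ** C) Q"
  have "degree Q' \<le> k"
    using degree_map_poly_le[of "\<lambda>M. M ** C" Q] Q(1) step.hyps(2,3) by (simp add: Q'_def)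
  then have "degree (P + Q') \<le> k" using P(1) by (rule degree_add_le[rotated])
  moreover have "mp_eval (P + Q') (of_real (2 * Re z)) = f z + f (cnj z)" if z: "z \<in> sphere 0 1" for z
  proof -
    have "z ^ nat \<bar>j\<bar> + cnj z ^ nat \<bar>j\<bar> = z powi j + cnj z powi j"
    proof (cases "0 \<le> j")
      case True
      then show ?thesis by (simp add: power_int_def)
    next
      case False
      have "cnj z \<in> sphere 0 1" using z by simp
      then show ?thesis
        using False circle_cnj_powi[OF z, of "- j"] circle_cnj_powi[of "cnj z" "- j"]
        by (simp add: power_int_def)
    qed
    then have "mp_eval Q' (of_real (2 * Re z)) = mat (z powi j) ** C + mat (cnj z powi j) ** C"
      unfolding Q'_def mp_eval_mult_right Q(2)[OF z] by (simp add: mat_add_distrib matrix_add_rdistrib)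
    then show ?thesis
      using P(2)[OF z] step.hyps(4)[OF z] step.hyps(4)[of "cnj z"] z
      unfolding mp_eval_add by (simp add: algebra_simps)
  qed
  ultimately show ?case by blast
qed

lemma laurent_polynomial_x:
  "laurent (- int (degree P)) (int (degree P)) (\<lambda>z. mp_eval P (of_real (2 * Re z)))"
proof (induction P)
  case 0
  show ?case by (rule laurent.zero) (simp add: mp_eval_def)
next
  case (pCons C P)
  have c: "laurent i j (\<lambda>z. C)" if "i \<le> 0" "0 \<le> j" for i j
    using laurent_monomial[of i 0 j C] that by simp
  have eq: "mp_eval (pCons C P) x = C + mat x ** mp_eval P x" for x
    using mp_eval_add[of "[:C:]" "pCons 0 P" x] by (simp add: mp_eval_shift)
  show ?case
  proof (cases "P = 0")
    case True
    then show ?thesis using c[of 0 0] by simp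
  next
    case False
    have "laurent (- (int (degree P) + 1)) (int (degree P) + 1)
        (\<lambda>z. C + xmul (\<lambda>z. mp_eval P (of_real (2 * Re z))) z)"
      by (intro laurent_add c xmul_laurent pCons.IH) auto
    then show ?thesis using False by (simp add: eq xmul_def add.commute)
  qed
qed

text \<open>Continuous integrands are Borel measurable, so the entries of the integral transport one by
one.\<close>

lemma mat_integral_szego:
  assumes "szego_image \<mu>C \<mu>I"
    and F: "\<And>i j. continuous_on UNIV (\<lambda>x. F x $ i $ j)"
    and G: "\<And>i j. continuous_on UNIV (\<lambda>x. G x $ i $ j)"
  shows "mat_integral interval \<mu>I F G = mat_integral circle \<mu>C (\<lambda>z. F (2 * Re z)) (\<lambda>z. G (2 * Re z))"
proof -
  have "(\<lambda>x. F x $ i $ m * G x $ n $ k) \<in> borel_measurable interval" for i m n k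
    by (intro borel_measurable_continuous_on_restrict continuous_on_mult
        continuous_on_subset[OF F] continuous_on_subset[OF G]) auto
  then show ?thesis
    using assms(1) unfolding mat_integral_def szego_image_def by simp
qed

lemma continuous_mp_eval_entry: "continuous_on UNIV (\<lambda>x::real. mp_eval P (of_real x) $ i $ j)"
  unfolding mp_eval_def by (simp add: continuous_intros)

section \<open>The Jacobi parameters\<close>

lemma mat_sqrt_inverse:
  assumes "posdef A"
  shows "mat_sqrt A ** matrix_inv (mat_sqrt A) = mat 1" "matrix_inv (mat_sqrt A) ** mat_sqrt A = mat 1"
    "adj (matrix_inv (mat_sqrt A)) = matrix_inv (mat_sqrt A)"
proof -
  let ?T = "mat_sqrt A"
  have sq: "?T ** ?T = A" and h: "adj ?T = ?T"
    using assms by (simp_all add: posdef_imp_psd mat_sqrt_square mat_sqrt_hermitian)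
  obtain B where "A ** B = mat 1" using posdef_inverse[OF assms] .
  then have "?T ** (?T ** B) = mat 1" by (simp add: matrix_mul_assoc sq)
  then show 1: "?T ** matrix_inv ?T = mat 1" using matrix_inv_eq by metis
  then show 2: "matrix_inv ?T ** ?T = mat 1" by (simp add: matrix_left_right_inverse)
  have "?T ** adj (matrix_inv ?T) = mat 1"
    using arg_cong[OF 2, of adj] by (simp add: adj_mult h)
  then show "adj (matrix_inv ?T) = matrix_inv ?T" using matrix_inv_eq by metis
qed

context symmetric_szego_recursion
begin

text \<open>The bound \<open>-1 < a < 1\<close> is read off from \<open>\<rho>\<^sup>2 = 1 - a\<^sup>2\<close>: twice \<open>1 - a\<close> is \<open>(1 - a)\<^sup>2 + \<rho>\<^sup>2\<close>, and likewise
for \<open>1 + a\<close>.\<close>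

lemma one_minus_a_posdef: "posdef (mat 1 - a n)" and one_plus_a_posdef: "posdef (mat 1 + a n)"
proof -
  have \<rho>\<rho>: "posdef (\<rho> n ** \<rho> n)"
    unfolding posdef_iff
  proof (intro conjI allI impI)
    show "adj (\<rho> n ** \<rho> n) = \<rho> n ** \<rho> n" by (simp add: adj_mult posdef_hermitian[OF \<rho>_pos])
    fix v :: "complex^'l" assume "v \<noteq> 0"
    then have "\<rho> n *v v \<noteq> 0" using \<rho>_pos[of n] unfolding posdef_iff by (metis inner_zero_right less_irrefl)
    moreover have "v \<bullet> ((\<rho> n ** \<rho> n) *v v) = (\<rho> n *v v) \<bullet> (\<rho> n *v v)"
      using inner_adj[of v "\<rho> n" "\<rho> n *v v"] by (simp add: matrix_vector_mul_assoc posdef_hermitian[OF \<rho>_pos])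
    ultimately show "0 < v \<bullet> ((\<rho> n ** \<rho> n) *v v)" by simp
  qed
  have "posdef ((1/2) *\<^sub>R ((mat 1 - a n) ** (mat 1 - a n) + \<rho> n ** \<rho> n))"
    by (intro posdef_scaleR posdef_psd_add psd_square \<rho>\<rho>) (simp_all add: adj_simps a_hermitian)
  also have "(1/2) *\<^sub>R ((mat 1 - a n) ** (mat 1 - a n) + \<rho> n ** \<rho> n) = (1/2) *\<^sub>R (2 *\<^sub>R (mat 1 - a n))"
    by (simp add: \<rho>_square matrix_ring_simps scaleR_2 algebra_simps del: scaleR_scaleR)
  finally show "posdef (mat 1 - a n)" by simp
  have "posdef ((1/2) *\<^sub>R ((mat 1 + a n) ** (mat 1 + a n) + \<rho> n ** \<rho> n))"
    by (intro posdef_scaleR posdef_psd_add psd_square \<rho>\<rho>) (simp_all add: adj_simps a_hermitian)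
  also have "(1/2) *\<^sub>R ((mat 1 + a n) ** (mat 1 + a n) + \<rho> n ** \<rho> n) = (1/2) *\<^sub>R (2 *\<^sub>R (mat 1 + a n))"
    by (simp add: \<rho>_square matrix_ring_simps scaleR_2 algebra_simps del: scaleR_scaleR)
  finally show "posdef (mat 1 + a n)" by simp
qed

lemma one_minus_b_posdef: "posdef (mat 1 - b n)"
proof (cases n)
  case 0
  have "posdef (mat 1 + mat 1 :: complex^'l^'l)"
    by (intro posdef_psd_add posdef_imp_psd posdef_mat1)
  then show ?thesis by (simp add: 0 b_def)
qed (simp add: b_def one_minus_a_posdef)

lemma one_plus_b_psd: "psd (mat 1 + b n)"
  by (cases n) (simp_all add: b_def psd_zero posdef_imp_psd one_plus_a_posdef)

definition T :: "nat \<Rightarrow> complex^'l^'l" where "T k = mat_sqrt (mat 1 - b (2 * k))"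

definition S :: "nat \<Rightarrow> complex^'l^'l" where "S k = mat_sqrt (mat 1 + b (2 * k))"

lemma T_square: "T k ** T k = mat 1 - b (2 * k)"
  by (simp add: T_def mat_sqrt_square posdef_imp_psd one_minus_b_posdef)

lemma T_S_commute: "T k ** S k = S k ** T k"
proof -
  have "b (2 * k) ** S k = S k ** b (2 * k)"
    unfolding S_def by (rule mat_sqrt_commute[OF one_plus_b_psd]) (simp add: matrix_ring_simps)
  then have "S k ** (mat 1 - b (2 * k)) = (mat 1 - b (2 * k)) ** S k"
    by (simp add: matrix_ring_simps)
  then show ?thesis
    unfolding T_def using mat_sqrt_commute[OF posdef_imp_psd[OF one_minus_b_posdef]] by metis
qed

text \<open>\<open>T\<close> and \<open>S\<close> commute, so their product is positive semi-definite; its square is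
\<open>(1 - b) (1 + b) = \<rho>\<^sup>2\<close>. This factorization of \<open>\<rho>\<close> is what turns the inner products of the \<open>e\<close> into the
Geronimus form.\<close>

lemma T_S_eq_\<rho>: "T (Suc k) ** S (Suc k) = \<rho> (Suc (2 * k))"
proof (rule psd_sqrt_unique)
  show "psd (T (Suc k) ** S (Suc k))"
    by (rule psd_mult_commuting[OF _ _ T_S_commute])
      (simp_all add: T_def S_def mat_sqrt_psd posdef_imp_psd one_minus_b_posdef one_plus_b_psd)
  show "psd (\<rho> (Suc (2 * k)))" by (rule posdef_imp_psd[OF \<rho>_pos])
  have S_square: "S (Suc k) ** S (Suc k) = mat 1 + b (2 * Suc k)"
    by (simp add: S_def mat_sqrt_square one_plus_b_psd)
  have "T (Suc k) ** S (Suc k) ** (T (Suc k) ** S (Suc k)) =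
      T (Suc k) ** T (Suc k) ** (S (Suc k) ** S (Suc k))"
    using T_S_commute[of "Suc k"] by (metis matrix_mul_assoc)
  also have "\<dots> = \<rho> (Suc (2 * k)) ** \<rho> (Suc (2 * k))"
    unfolding T_square S_square \<rho>_square by (simp add: b_def matrix_ring_simps)
  finally show "T (Suc k) ** S (Suc k) ** (T (Suc k) ** S (Suc k)) = \<rho> (Suc (2 * k)) ** \<rho> (Suc (2 * k))" .
qed

definition T' :: "nat \<Rightarrow> complex^'l^'l" where "T' k = matrix_inv (T k)"

lemma T_T' [simp]: "T k ** T' k = mat 1" and T'_T [simp]: "T' k ** T k = mat 1"
  and T'_hermitian: "adj (T' k) = T' k"
  unfolding T'_def T_def by (rule mat_sqrt_inverse[OF one_minus_b_posdef])+

lemma T_0: "T 0 = sqrt 2 *\<^sub>R mat 1"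
  unfolding T_def
  by (rule mat_sqrt_eqI)
    (simp_all add: psd_scaleR posdef_imp_psd posdef_mat1 matrix_ring_simps b_def scaleR_2)

lemma T'_0: "T' 0 = (1 / sqrt 2) *\<^sub>R mat 1"
  unfolding T'_def by (rule matrix_inv_eq) (simp add: T_0 matrix_ring_simps)

text \<open>The squared norm of \<open>e\<close> is \<open>2 (1 - b) = 2 T\<^sup>2\<close>, and normalizing on the right by the inverse of \<open>\<surd>2 T\<close> gives right
orthonormal polynomials in \<open>x\<close>. Among the equivalent normalizations, this one with a Hermitian factor
is the one whose Jacobi parameters have the Geronimus form.\<close>

definition p :: "nat \<Rightarrow> complex \<Rightarrow> complex^'l^'l" where
  "p k z = e k z ** ((1 / sqrt 2) *\<^sub>R T' k)"

lemma R_p: 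
  assumes "circle_cont f"
  shows "R (p k) (\<lambda>z. f z ** ((1 / sqrt 2) *\<^sub>R T' m)) = (1/2) *\<^sub>R (T' k ** R (e k) f ** T' m)"
  unfolding p_def[abs_def]
  by (simp only: R_mult_left R_mult_right e_cont assms circle_cont_mult circle_cont_const)
    (simp add: adj_scaleR T'_hermitian matrix_scaleR_left matrix_scaleR_right matrix_mul_assoc)

lemma p_orthonormal: "R (p n) (p m) = (if n = m then mat 1 else 0)"
proof -
  have eq: "R (p n) (p m) = (1/2) *\<^sub>R (T' n ** R (e n) (e m) ** T' m)"
    using R_p[OF e_cont, of n m m] by (simp add: p_def[abs_def])
  have 0: "R (e i) (e j) = 0" if "i < j" for i j
    by (rule R_e_perp[OF e_laurent]) (use that in simp)
  consider "n = m" | "n < m" | "m < n" by linarith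
  then show ?thesis
  proof cases
    case 1
    have "T' n ** (T n ** T n) ** T' n = (T' n ** T n) ** (T n ** T' n)" by (simp add: matrix_mul_assoc)
    then show ?thesis using eq by (simp add: 1 R_e_e T_square[symmetric] matrix_ring_simps)
  next
    case 2
    then show ?thesis by (simp add: eq 0)
  next
    case 3
    have "R (e n) (e m) = 0" using 0[OF 3] by (metis R_adj adj_zero)
    then show ?thesis using 3 by (simp add: eq)
  qed
qed

lemma R_p_x_p: "R (p n) (xmul (p m)) = (1/2) *\<^sub>R (T' n ** R (e n) (xmul (e m)) ** T' m)"
proof -
  have "xmul (p m) = (\<lambda>z. xmul (e m) z ** ((1 / sqrt 2) *\<^sub>R T' m))"
    by (simp add: fun_eq_iff xmul_def p_def matrix_mul_assoc)
  then show ?thesis using R_p[OF xmul_cont[OF e_cont]] by simp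
qed

lemma R_p_x_p_adj: "R (p n) (xmul (p m)) = adj (R (p m) (xmul (p n)))"
  by (metis R_adj R_xmul)

lemma R_p_x_p_diag_0: "R (p 0) (xmul (p 0)) = T 0 ** a 0 ** T 0"
  by (simp add: R_p_x_p R_e_x_e_diag_0 T_0 T'_0 matrix_ring_simps)

lemma R_p_x_p_diag_Suc:
  "R (p (Suc k)) (xmul (p (Suc k))) =
    T (Suc k) ** a (2 * Suc k) ** T (Suc k) - S (Suc k) ** a (2 * k) ** S (Suc k)"
proof -
  let ?T = "T (Suc k)" and ?T' = "T' (Suc k)" and ?S = "S (Suc k)"
  have sq: "mat 1 - a (Suc (2 * k)) = ?T ** ?T" by (simp add: T_square b_def)
  have "R (p (Suc k)) (xmul (p (Suc k))) =
      ?T' ** ((?T ** ?T) ** a (2 * Suc k) ** (?T ** ?T) - (?T ** ?S) ** a (2 * k) ** (?S ** ?T)) ** ?T'"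
    using T_S_eq_\<rho>[of k] T_S_commute[of "Suc k"]
    by (simp add: R_p_x_p R_e_x_e_diag_Suc sq matrix_ring_simps)
  also have "\<dots> = (?T' ** ?T) ** ?T ** a (2 * Suc k) ** ?T ** (?T ** ?T') -
      (?T' ** ?T) ** ?S ** a (2 * k) ** ?S ** (?T ** ?T')"
    by (simp only: matrix_ring_simps matrix_mul_assoc)
  finally show ?thesis by simp
qed

lemma R_p_x_p_Suc: "R (p k) (xmul (p (Suc k))) = T k ** \<rho> (2 * k) ** S (Suc k)"
proof -
  have "R (p k) (xmul (p (Suc k))) = T' k ** ((T k ** T k) ** \<rho> (2 * k) ** (S (Suc k) ** T (Suc k))) ** T' (Suc k)"
    using T_S_eq_\<rho>[of k] T_S_commute[of "Suc k"]
    by (simp add: R_p_x_p R_e_x_e_Suc T_square[symmetric] matrix_ring_simps)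
  also have "\<dots> = (T' k ** T k) ** T k ** \<rho> (2 * k) ** S (Suc k) ** (T (Suc k) ** T' (Suc k))"
    by (simp only: matrix_mul_assoc)
  finally show ?thesis by simp
qed

lemma R_p_x_p_far: "Suc n < m \<Longrightarrow> R (p n) (xmul (p m)) = 0"
  by (simp add: R_p_x_p R_e_x_e_far)

text \<open>The degree is exactly \<open>k\<close>: a polynomial of lower degree in \<open>x\<close> would be orthogonal to \<open>e\<close>, and then \<open>p\<close> would
be orthogonal to itself.\<close>

lemma p_polynomial: "\<exists>P. degree P = k \<and> (\<forall>z\<in>sphere 0 1. mp_eval P (of_real (2 * Re z)) = p k z)"
proof -
  obtain Q where Q: "degree Q \<le> k"
    "\<And>z. z \<in> sphere 0 1 \<Longrightarrow> mp_eval Q (of_real (2 * Re z)) = e k z"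
    using symmetrized_laurent_polynomial[OF u_laurent] e_eq by metis
  define D where "D = (1 / sqrt 2) *\<^sub>R T' k"
  define P where "P = map_poly (\<lambda>M. M ** D) Q"
  have P: "mp_eval P (of_real (2 * Re z)) = p k z" if "z \<in> sphere 0 1" for z
    unfolding P_def mp_eval_mult_right Q(2)[OF that] by (simp add: p_def D_def)
  have "degree P \<le> k"
    using degree_map_poly_le[of "\<lambda>M. M ** D" Q] Q(1) by (simp add: P_def)
  moreover have "\<not> degree P < k"
  proof
    assume less: "degree P < k"
    have "laurent (- int (degree P)) (int (degree P)) (p k)"
      by (rule laurent_cong[OF laurent_polynomial_x]) (simp only: P)
    then have "R (p k) (e k) = 0" by (rule R_e_perp) (use less in simp)
    moreover have "R (p k) (p k) = R (p k) (e k) ** D"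
      unfolding p_def[of k, abs_def] D_def[symmetric]
      by (rule R_mult_right) (intro circle_cont_mult circle_cont_const e_cont)+
    moreover have "(mat 1 :: complex^'l^'l) \<noteq> 0" by (simp add: vec_eq_iff mat_def)
    ultimately show False by (simp add: p_orthonormal)
  qed
  ultimately show ?thesis using P by (metis le_neq_implies_less)
qed

lemma p_0:
  assumes "z \<in> sphere 0 1"
  shows "p 0 z = mat 1"
proof -
  have "e 0 z = mat 1 + mat 1" using assms by (simp add: e_def \<phi>s_def \<phi>_0)
  then show ?thesis by (simp add: p_def T'_0 scaleR_2[symmetric] matrix_ring_simps)
qed

lemma block_jacobi_matrix_of_szego_image:
  assumes sz: "szego_image \<mu> \<mu>I"
    and B0: "B (Suc 0) = T 0 ** a 0 ** T 0"
    and B: "\<And>k. B (Suc (Suc k)) =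
      T (Suc k) ** a (2 * Suc k) ** T (Suc k) - S (Suc k) ** a (2 * k) ** S (Suc k)"
    and A: "\<And>k. A (Suc k) = T k ** \<rho> (2 * k) ** S (Suc k)"
  shows "block_jacobi_matrix \<mu>I (block_tridiagonal A B)"
proof -
  obtain P where P: "\<And>k. degree (P k) = k"
    "\<And>k z. z \<in> sphere 0 1 \<Longrightarrow> mp_eval (P k) (of_real (2 * Re z)) = p k z"
    using p_polynomial by metis
  have P0: "P 0 = [:mat 1:]"
  proof -
    obtain C where C: "P 0 = [:C:]" using P(1)[of 0] by (rule degree_eq_zeroE)
    then show ?thesis using P(2)[of 1 0] p_0[of 1] by simp
  qed
  have transport: "mat_integral interval \<mu>I (\<lambda>x. adj (mp_eval (P n) (of_real x))) G = R (p n) H"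
    if "\<And>i j. continuous_on UNIV (\<lambda>x. G x $ i $ j)" "\<And>z. z \<in> sphere 0 1 \<Longrightarrow> G (2 * Re z) = H z" for n G H
  proof -
    have "mat_integral interval \<mu>I (\<lambda>x. adj (mp_eval (P n) (of_real x))) G =
        R (\<lambda>z. mp_eval (P n) (of_real (2 * Re z))) (\<lambda>z. G (2 * Re z))"
      unfolding inner_R_def
      by (rule mat_integral_szego[OF sz _ that(1)])
        (simp add: adj_entry continuous_on_cnj continuous_mp_eval_entry)
    also have "\<dots> = R (p n) H" by (rule R_cong) (simp_all only: P(2) that(2))
    finally show ?thesis .
  qed
  have orth: "mat_integral interval \<mu>I (\<lambda>x. adj (mp_eval (P n) (of_real x))) (\<lambda>x. mp_eval (P m) (of_real x)) =
      (if n = m then mat 1 else 0)" for n m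
    unfolding p_orthonormal[symmetric] by (rule transport) (rule continuous_mp_eval_entry, rule P(2))
  have entry: "mat_integral interval \<mu>I (\<lambda>x. adj (mp_eval (P n) (of_real x)))
      (\<lambda>x. mat (of_real x) ** mp_eval (P m) (of_real x)) = R (p n) (xmul (p m))" for n m
  proof (rule transport)
    show "continuous_on UNIV (\<lambda>x::real. (mat (of_real x) ** mp_eval (P m) (of_real x)) $ i $ j)" for i j
      using continuous_mp_eval_entry[of "P m" i j] by (simp add: continuous_on_mult continuous_on_of_real_id)
    show "mat (of_real (2 * Re z)) ** mp_eval (P m) (of_real (2 * Re z)) = xmul (p m) z"
      if "z \<in> sphere 0 1" for z
      unfolding P(2)[OF that] xmul_def ..
  qed
  have jacobi: "block_tridiagonal A B (Suc n) (Suc m) = R (p n) (xmul (p m))" for n m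
  proof -
    consider "n = m" | "m = Suc n" | "n = Suc m" | "Suc n < m" | "Suc m < n" by linarith
    then show ?thesis
    proof cases
      case 1
      show ?thesis
        unfolding 1 by (cases m) (simp_all add: block_tridiagonal_def B0 B R_p_x_p_diag_0 R_p_x_p_diag_Suc)
    next
      case 2
      then show ?thesis by (simp add: block_tridiagonal_def A R_p_x_p_Suc)
    next
      case 3
      then show ?thesis by (simp add: block_tridiagonal_def A R_p_x_p_Suc R_p_x_p_adj[of "Suc m" m])
    next
      case 4
      then show ?thesis by (simp add: block_tridiagonal_def R_p_x_p_far)
    next
      case 5
      then show ?thesis by (simp add: block_tridiagonal_def R_p_x_p_far R_p_x_p_adj[of n m])
    qed
  qed
  have "block_tridiagonal A B n m = mat_integral interval \<mu>I (\<lambda>x. adj (mp_eval (P (n - 1)) (of_real x)))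
      (\<lambda>x. mat (of_real x) ** mp_eval (P (m - 1)) (of_real x))" if "1 \<le> n" "1 \<le> m" for n m
    using jacobi[of "n - 1" "m - 1"] that by (simp add: entry)
  then show ?thesis
    unfolding block_jacobi_matrix_def Let_def using P(1) P0 orth by blast
qed

end

theorem theorem4p2:
  fixes \<mu>C :: "complex set \<Rightarrow> complex^'l^'l"
    and \<mu>I :: "real set \<Rightarrow> complex^'l^'l"
    and \<alpha> :: "int \<Rightarrow> complex^'l^'l"
    and A B :: "nat \<Rightarrow> complex^'l^'l"
  assumes "matrix_measure circle \<mu>C"
    and "nontrivial \<mu>C"
    and "\<mu>C (sphere 0 1) = mat 1"
    and "conj_invariant \<mu>C"
    and "verblunsky \<mu>C (\<lambda>n. \<alpha> (int n))"
    and "\<alpha> (-1) = - mat 1"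
    and "szego_image \<mu>C \<mu>I"
    and "\<And>k::nat. B (k + 1) =
           mat_sqrt (mat 1 - \<alpha> (2 * int k - 1)) ** \<alpha> (2 * int k)
             ** mat_sqrt (mat 1 - \<alpha> (2 * int k - 1))
         - mat_sqrt (mat 1 + \<alpha> (2 * int k - 1)) ** \<alpha> (2 * int k - 2)
             ** mat_sqrt (mat 1 + \<alpha> (2 * int k - 1))"
    and "\<And>k::nat. A (k + 1) =
           mat_sqrt (mat 1 - \<alpha> (2 * int k - 1))
             ** mat_sqrt (mat 1 - \<alpha> (2 * int k) ** \<alpha> (2 * int k))
             ** mat_sqrt (mat 1 + \<alpha> (2 * int k + 1))"
  shows "block_jacobi_matrix \<mu>I (block_tridiagonal A B)"
proof -
  interpret symmetric_circle_measure \<mu>C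
    using assms(1,3,4) by unfold_locales
  obtain \<phi> \<rho> where "symmetric_szego_recursion \<mu>C \<phi> \<rho> (\<lambda>n. \<alpha> (int n))"
    using symmetric_szego_recursion_of_verblunsky[OF assms(2,5)] .
  then interpret symmetric_szego_recursion \<mu>C \<phi> \<rho> "\<lambda>n. \<alpha> (int n)" .
  have b_eq: "b (2 * k) = \<alpha> (2 * int k - 1)" for k
    by (cases k) (simp_all add: b_def assms(6))
  have T_eq: "T k = mat_sqrt (mat 1 - \<alpha> (2 * int k - 1))" and
    S_eq: "S k = mat_sqrt (mat 1 + \<alpha> (2 * int k - 1))" for k
    by (simp_all add: T_def S_def b_eq)
  have S0: "mat_sqrt (mat 1 + \<alpha> (2 * int 0 - 1)) = 0"
    by (rule mat_sqrt_eqI) (simp_all add: psd_zero assms(6))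
  show ?thesis
  proof (rule block_jacobi_matrix_of_szego_image[OF assms(7)])
    show "B (Suc 0) = T 0 ** \<alpha> (int 0) ** T 0"
      using assms(8)[of 0] unfolding S0 by (simp add: T_eq)
    show "B (Suc (Suc k)) = T (Suc k) ** \<alpha> (int (2 * Suc k)) ** T (Suc k) -
        S (Suc k) ** \<alpha> (int (2 * k)) ** S (Suc k)" for k
      using assms(8)[of "Suc k"] by (simp add: T_eq S_eq algebra_simps)
    show "A (Suc k) = T k ** \<rho> (2 * k) ** S (Suc k)" for k
      using assms(9)[of k] \<rho>_eq[of "2 * k"] by (simp add: T_eq S_eq algebra_simps)
  qed
qed

end
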